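(* Let $n\ge 2$ and let $Z \subset \mathbb{R}^n$ be a zonotope with non-empty interior and with at most $n+1$ generators. Then $$L_Z \geq L_{Q_n},$$ with equality if and only if $Z$ is affinely equivalent to $Q_n$, where $$Q_n = \sum_{i=1}^n[-e_i,e_i] + [-(e_1+e_2+\dots+e_n),\,e_1+e_2+\dots+e_n]\subset\mathbb{R}^n.$$
   Context: For a compact convex set $K\subset\mathbb{R}^n$ with non-empty interior, the covariance matrix is $A_K = \mathbb{E}[XX^{\mathsf T}] - \mathbb{E}[X]\mathbb{E}[X]^{\mathsf T}$, where $X$ is uniformly distributed on $K$, and the isotropic constant $L_K>0$ is defined by $L_K^{2n} = \det A_K/(\mathrm{vol}\, K)^2$ (an affine invariant). A zonotope with at most $n+1$ generators is a set of the form $Z=c+\sum_{i=1}^m[-z_i,z_i]$ (Minkowski sum) with $c,z_1,\dots,z_m\in\mathbb{R}^n$ and $m\le n+1$. Here $e_1,\dots,e_n$ is the standard basis of $\mathbb{R}^n$. *)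

theory Defs
  imports "HOL-Analysis.Analysis"
begin

text \<open>Addition and finite sums of sets are Minkowski sums (\<^theory>\<open>HOL-Library.Set_Algebras\<close>);
  in particular the sum over an empty index set is \<open>{0}\<close>.\<close>

definition zonotope :: "nat \<Rightarrow> 'a::real_vector set \<Rightarrow> bool" where
  "zonotope m Z \<longleftrightarrow>
     (\<exists>(c::'a) (z :: nat \<Rightarrow> 'a). Z = {c} + (\<Sum>i<m. closed_segment (- z i) (z i)))"

definition mean_vector :: "(real ^ 'n) set \<Rightarrow> real ^ 'n" where
  "mean_vector K = (\<chi> i. \<integral>x. x $ i \<partial>uniform_measure lborel K)"

definition second_moment_matrix :: "(real ^ 'n) set \<Rightarrow> real ^ 'n ^ 'n" where
  "second_moment_matrix K = (\<chi> i j. \<integral>x. x $ i * x $ j \<partial>uniform_measure lborel K)"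

definition covariance_matrix :: "(real ^ 'n) set \<Rightarrow> real ^ 'n ^ 'n" where
  "covariance_matrix K =
     second_moment_matrix K - (\<chi> i j. mean_vector K $ i * mean_vector K $ j)"

definition isotropic_constant :: "(real ^ 'n) set \<Rightarrow> real" where
  "isotropic_constant K =
     root (2 * CARD('n)) (det (covariance_matrix K) / (measure lborel K)\<^sup>2)"

lemma isotropic_constant_unique:
  fixes K :: "(real ^ 'n) set"
  assumes "L > 0" and "L ^ (2 * CARD('n)) = det (covariance_matrix K) / (measure lborel K)\<^sup>2"
  shows "isotropic_constant K = L"
  using assms by (simp add: isotropic_constant_def real_root_power_cancel flip: assms(2))

definition affinely_equivalent :: "'a::real_vector set \<Rightarrow> 'a set \<Rightarrow> bool" where
  "affinely_equivalent S T \<longleftrightarrow> (\<exists>f b. linear f \<and> bij f \<and> T = (\<lambda>x. f x + b) ` S)"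

definition Q_zonotope :: "(real ^ 'n) set" where
  "Q_zonotope =
     (\<Sum>i\<in>UNIV. closed_segment (- axis i 1) (axis i 1))
     + closed_segment (- (\<Sum>i\<in>UNIV. axis i 1)) (\<Sum>i\<in>UNIV. axis i 1)"

end

theory Submission
  imports Defs
begin

text \<open>
  Up to an affine map, a full-dimensional zonotope in \<open>\<real>\<^sup>n\<close> with at most \<open>n + 1\<close> generators is \<open>C + [-a, a]\<close> with the
  cube \<open>C = [-1, 1]\<^sup>n\<close> and a vector \<open>a\<close> with nonnegative coordinates
  (\<open>zonotope_eq_affine_image_cube_zonotope\<close>), and \<open>a = 1\<close> gives \<open>Q\<^sub>n\<close>. As the isotropic constant is an affine
  invariant, the task is to minimise it over \<open>a\<close>.

  The zonotope \<open>C + [-a, a]\<close> is tiled by \<open>n + 1\<close> parallelepipeds, one for each generator \<open>z\<^sub>s\<close>: the tile of \<open>z\<^sub>s\<close>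
  is a translate, by \<open>z\<^sub>s\<close> up to sign, of the sum of the segments of all other generators. If \<open>p\<^sub>s\<close>
  denotes the share of the volume that this tile takes up, then summing the moments of the tiles shows
  that the mean is zero and that the covariance matrix is \<open>(1/3) \<Sum>s. (1 + 2 p\<^sub>s) z\<^sub>s z\<^sub>s\<^sup>T\<close>. Its
  determinant is that of a diagonal matrix plus a matrix of rank one, and it yields
  \<open>det A / vol\<^sup>2 = 12\<^sup>-\<^sup>n \<Sum>s. p\<^sub>s\<^sup>2 \<Prod>t\<noteq>s. (1 + 2 p\<^sub>t)\<close>
  (\<open>isotropic_constant_cube_zonotope\<close>).

  What remains is an inequality for probability vectors with at least three entries: the right-hand side
  is smallest exactly if all \<open>p\<^sub>s\<close> are equal (\<open>moment_factor_minimal_at_constant\<close>). With the sum of two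
  entries kept fixed, it does not increase when they approach each other, so entries can be moved to the mean
  one after the other. Equal shares mean \<open>a = 1\<close>, which settles the case of equality.
\<close>

section \<open>A symmetric function minimised at the constant vector\<close>

text \<open>
  If \<open>p\<close> is a probability vector on an \<open>N\<close>-element index set and \<open>y = 1 + 2 p\<close>, so that the entries of
  \<open>y\<close> sum to \<open>N + 2\<close>, this is four times \<open>\<Sum>i. (p i)\<^sup>2 * (\<Prod>j\<noteq>i. 1 + 2 * p j)\<close>: expand
  \<open>p\<^sup>2 / y = (y - 2 + 1 / y) / 4\<close> and sum. The form below separates any two
  coordinates cleanly from the others.
\<close>

definition moment_factor :: "('b::finite \<Rightarrow> real) \<Rightarrow> real" where
  "moment_factor y = (\<Prod>i\<in>UNIV. y i) * ((\<Sum>i\<in>UNIV. 1 / y i) - (real CARD('b) - 2))"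

text \<open>
  When \<open>y i + y j\<close> is kept fixed, only the product \<open>y i * y j\<close> varies, and it enters with the
  sign of \<open>- C\<close>, where \<open>C\<close> is the sum of \<open>1 - 1 / y k\<close> over the remaining indices. If all entries are at
  least 1, then \<open>C \<ge> 0\<close>, so that bringing two coordinates closer together cannot increase the value.
\<close>

lemma moment_factor_two_coordinates:
  fixes y :: "'b::finite \<Rightarrow> real"
  assumes "i \<noteq> j" and pos: "y i \<noteq> 0" "y j \<noteq> 0"
  shows "moment_factor y =
    (\<Prod>k\<in>UNIV - {i, j}. y k) *
      (y i + y j - y i * y j * (\<Sum>k\<in>UNIV - {i, j}. 1 - 1 / y k))"
proof -
  have U: "UNIV = insert i (insert j (UNIV - {i, j}))" by auto
  have prod: "(\<Prod>k\<in>UNIV. y k) = y i * (y j * (\<Prod>k\<in>UNIV - {i, j}. y k))"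
    by (subst U, subst prod.insert, use \<open>i \<noteq> j\<close> in \<open>auto\<close>)
  have sum: "(\<Sum>k\<in>UNIV. 1 / y k) = 1 / y i + (1 / y j + (\<Sum>k\<in>UNIV - {i, j}. 1 / y k))"
    by (subst U, subst sum.insert, use \<open>i \<noteq> j\<close> in \<open>auto\<close>)
  have "card (insert i (insert j (UNIV - {i, j}))) = Suc (Suc (card (UNIV - {i, j})))"
    using \<open>i \<noteq> j\<close> by (subst card_insert_disjoint; simp)+
  then have "CARD('b) = 2 + card (UNIV - {i, j})"
    using U by simp
  then have card: "real CARD('b) - 2 = card (UNIV - {i, j})" by simp
  show ?thesis
    unfolding moment_factor_def prod sum card sum_subtractf
    using pos by (simp add: field_simps)
qed

text \<open>
  Smoothing: as long as \<open>y\<close> is not constant, some coordinate lies below the mean \<open>\<mu>\<close> and another one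
  above it. Moving the first to \<open>\<mu>\<close> and compensating with the second does not increase the value and
  makes one more coordinate equal to \<open>\<mu>\<close>. Strictness comes from the move that arrives at the constant
  vector: there every remaining coordinate equals \<open>\<mu> > 1\<close>, and with at least three indices there is
  one, so that the constant \<open>C\<close> of the preceding lemma is positive.
\<close>

lemma moment_factor_minimal_at_constant:
  fixes y :: "'b::finite \<Rightarrow> real" and \<mu> :: real
  assumes "3 \<le> CARD('b)" and "\<And>i. 1 \<le> y i" and "(\<Sum>i\<in>UNIV. y i) = real CARD('b) * \<mu>"
    and "1 < \<mu>" and "\<exists>i. y i \<noteq> \<mu>"
  shows "moment_factor (\<lambda>i::'b. \<mu>) < moment_factor y"
  using assms(2,3,5)
proof (induction "card {i. y i \<noteq> \<mu>}" arbitrary: y rule: less_induct)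
  case less
  have dev: "(\<Sum>i\<in>UNIV. y i - \<mu>) = 0"
    using less.prems(2) by (simp add: sum_subtractf)
  obtain i where i: "y i < \<mu>"
  proof (rule ccontr)
    assume "\<not> thesis"
    then have "\<forall>i. 0 \<le> y i - \<mu>" using that by (force simp: not_less)
    then have "\<forall>i. y i - \<mu> = 0" using dev by (simp add: sum_nonneg_eq_0_iff)
    then show False using less.prems(3) by auto
  qed
  obtain j where j: "\<mu> < y j"
  proof (rule ccontr)
    assume "\<not> thesis"
    then have "\<forall>i. y i - \<mu> \<le> 0" using that by (force simp: not_less)
    moreover have "(\<Sum>i\<in>UNIV. - (y i - \<mu>)) = 0" using dev by (simp only: sum_negf)
    ultimately have "\<forall>i. - (y i - \<mu>) = 0"
      by (subst (asm) sum_nonneg_eq_0_iff) auto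
    then show False using less.prems(3) by auto
  qed
  have ij: "i \<noteq> j" using i j by auto
  define y' where "y' = y(i := \<mu>, j := y i + y j - \<mu>)"
  let ?R = "UNIV - {i, j}"
  have rest: "y' k = y k" if "k \<in> ?R" for k using that by (auto simp: y'_def)
  have y'ij: "y' i = \<mu>" "y' j = y i + y j - \<mu>" using ij by (auto simp: y'_def)
  have ge1: "1 \<le> y' k" for k
    using less.prems(1)[of k] less.prems(1)[of i] less.prems(1)[of j] i j \<open>1 < \<mu>\<close> by (auto simp: y'_def)
  have "(\<Sum>k\<in>UNIV. y' k) = (\<Sum>k\<in>insert i (insert j ?R). y' k)"
    by (rule sum.cong) auto
  also have "\<dots> = y i + y j + (\<Sum>k\<in>?R. y' k)"
    using ij y'ij by simp
  also have "\<dots> = y i + y j + (\<Sum>k\<in>?R. y k)"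
    using sum.cong[of ?R ?R y' y] rest by simp
  also have "\<dots> = (\<Sum>k\<in>insert i (insert j ?R). y k)"
    using ij by simp
  also have "insert i (insert j ?R) = UNIV" by auto
  finally have sum': "(\<Sum>k\<in>UNIV. y' k) = real CARD('b) * \<mu>" using less.prems(2) by simp
  have fewer: "card {k. y' k \<noteq> \<mu>} < card {k. y k \<noteq> \<mu>}"
    by (rule psubset_card_mono) (use i j ij in \<open>auto simp: y'_def split: if_splits\<close>)

  define R where "R = (\<Prod>k\<in>?R. y k)"
  define C where "C = (\<Sum>k\<in>?R. 1 - 1 / y k)"
  have nz: "y i \<noteq> 0" "y j \<noteq> 0" "y' i \<noteq> 0" "y' j \<noteq> 0"
    using less.prems(1)[of i] less.prems(1)[of j] ge1[of i] ge1[of j] by auto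
  have F: "moment_factor y = R * (y i + y j - y i * y j * C)"
    using moment_factor_two_coordinates[of i j y] ij nz unfolding R_def C_def by simp
  have F': "moment_factor y' = R * (y i + y j - \<mu> * (y i + y j - \<mu>) * C)"
  proof -
    have "(\<Prod>k\<in>?R. y' k) = R" unfolding R_def by (rule prod.cong) (simp_all add: rest)
    moreover have "(\<Sum>k\<in>?R. 1 - 1 / y' k) = C" unfolding C_def by (rule sum.cong) (simp_all add: rest)
    ultimately show ?thesis
      using moment_factor_two_coordinates[of i j y'] ij nz by (simp add: y'ij)
  qed
  have diff: "moment_factor y - moment_factor y' = R * C * ((\<mu> - y i) * (y j - \<mu>))"
    unfolding F F' by (simp add: algebra_simps)
  have Rpos: "0 < R"
    unfolding R_def by (rule prod_pos) (meson less.prems(1) less_le_trans zero_less_one)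
  have gap: "0 < (\<mu> - y i) * (y j - \<mu>)" using i j by simp
  have term_nonneg: "0 \<le> 1 - 1 / y k" for k
    using less.prems(1)[of k] by (simp add: divide_le_eq)
  then have C0: "0 \<le> C" unfolding C_def by (intro sum_nonneg)
  have "0 \<le> R * C * ((\<mu> - y i) * (y j - \<mu>))"
    using Rpos C0 gap by simp
  with diff have le: "moment_factor y' \<le> moment_factor y" by linarith
  show ?case
  proof (cases "\<exists>k. y' k \<noteq> \<mu>")
    case True
    from less.hyps[OF fewer ge1 sum' True] le show ?thesis by simp
  next
    case False
    then have const: "y' = (\<lambda>k. \<mu>)" by auto
    have "?R \<noteq> {}"
    proof
      assume "?R = {}"
      then have "UNIV = {i, j}" by auto
      then have "CARD('b) = card {i, j}" by simp
      then show False using assms(1) ij by simp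
    qed
    moreover have "0 < 1 - 1 / y k" if "k \<in> ?R" for k
      using rest[OF that] const \<open>1 < \<mu>\<close> by simp
    ultimately have "0 < C" unfolding C_def by (intro sum_pos) auto
    then have "0 < R * C * ((\<mu> - y i) * (y j - \<mu>))" using Rpos gap by simp
    then show ?thesis
      using diff const by simp
  qed
qed

section \<open>Determinant of a diagonal matrix plus a rank-one matrix\<close>

text \<open>
  The rank-one update is performed row by row. By linearity in row \<open>k\<close>, adding \<open>u $ k\<close> times \<open>v\<close> to the
  unit row \<open>k\<close> changes the determinant by \<open>u $ k\<close> times that of the matrix with \<open>v\<close> itself in row \<open>k\<close>;
  in the latter, row operations turn all other rows back into unit rows, which leaves \<open>v $ k\<close>.
\<close>

lemma det_identity_plus_rank_one_rows:
  fixes u v :: "real^'n" and S :: "'n set"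
  shows "det (\<chi> i. if i \<in> S then axis i 1 + u $ i *\<^sub>R v else axis i 1) = 1 + (\<Sum>i\<in>S. u $ i * v $ i)"
    (is "det (?M S) = _")
proof -
  have v_row: "det (\<chi> i. if i = k then v else if i \<in> T then axis i 1 + u $ i *\<^sub>R v else axis i 1) = v $ k"
    (is "det (?N T) = _") if "finite T" "k \<notin> T" for T k
    using that
  proof (induction T rule: finite_induct)
    case empty
    have "?N {} = transpose (\<chi> i j. if j = k then v $ i else mat 1 $ i $ j)"
      by (simp add: vec_eq_iff transpose_def mat_def axis_def)
    also have "det \<dots> = det ((\<chi> i j. if j = k then (mat 1 *v v) $ i else mat 1 $ i $ j) :: real^'n^'n)"
      by (simp only: det_transpose matrix_vector_mul_lid)
    also have "\<dots> = v $ k * det (mat 1 :: real^'n^'n)"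
      by (rule cramer_lemma)
    finally show ?case by simp
  next
    case (insert j T)
    then have "j \<noteq> k" by auto
    have "?N (insert j T) = (\<chi> i. if i = j then row j (?N T) + u $ j *s row k (?N T) else row i (?N T))"
      using insert.hyps \<open>j \<noteq> k\<close> by (auto simp: vec_eq_iff row_def scalar_mult_eq_scaleR)
    then show ?case
      using det_row_operation[OF \<open>j \<noteq> k\<close>, of "?N T" "u $ j"] insert by simp
  qed
  have "finite S" by simp
  then show ?thesis
  proof (induction S rule: finite_induct)
    case empty
    have "?M {} = mat 1" by (simp add: vec_eq_iff mat_def axis_def)
    then show ?case by simp
  next
    case (insert k T)
    have "det (?M (insert k T)) =
        det (\<chi> i. if i = k then axis k 1 + u $ k *s v else ?M T $ i)"
      by (rule arg_cong[where f = det]) (auto simp: vec_eq_iff scalar_mult_eq_scaleR)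
    also have "\<dots> = det (\<chi> i. if i = k then axis k 1 else ?M T $ i)
        + u $ k * det (\<chi> i. if i = k then v else ?M T $ i)"
      by (simp only: det_row_add[where a = "\<lambda>_. axis k 1" and b = "\<lambda>_. u $ k *s v"]
          det_row_mul[where a = "\<lambda>_. v"])
    also have "(\<chi> i. if i = k then axis k 1 else ?M T $ i) = ?M T"
      using insert.hyps by (auto simp: vec_eq_iff)
    also have "(\<chi> i. if i = k then v else ?M T $ i) =
        (\<chi> i. if i = k then v else if i \<in> T then axis i 1 + u $ i *\<^sub>R v else axis i 1)"
      by (simp add: vec_eq_iff)
    finally show ?case
      using insert v_row[of T k] by simp
  qed
qed

lemma det_diagonal_plus_rank_one:
  fixes d u v :: "'n::finite \<Rightarrow> real"
  assumes "\<And>i. d i \<noteq> 0"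
  shows "det (\<chi> i j. (if i = j then d i else 0) + u i * v j) =
    (\<Prod>i\<in>UNIV. d i) * (1 + (\<Sum>i\<in>UNIV. u i * v i / d i))"
proof -
  let ?u = "\<chi> i. u i / d i" and ?v = "\<chi> j. v j"
  have "(\<chi> i j. (if i = j then d i else 0) + u i * v j) =
      (\<chi> i. d i *s (\<chi> i. if i \<in> UNIV then axis i 1 + ?u $ i *\<^sub>R ?v else axis i 1) $ i)"
    using assms by (auto simp: vec_eq_iff axis_def distrib_left)
  then have "det (\<chi> i j. (if i = j then d i else 0) + u i * v j) =
    (\<Prod>i\<in>UNIV. d i) * det (\<chi> i. (\<chi> i. if i \<in> UNIV then axis i 1 + ?u $ i *\<^sub>R ?v else axis i 1) $ i)"
    by (simp only: det_rows_mul)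
  also have "(\<chi> i. (\<chi> i. if i \<in> UNIV then axis i 1 + ?u $ i *\<^sub>R ?v else axis i 1) $ i)
      = (\<chi> i. if i \<in> UNIV then axis i 1 + ?u $ i *\<^sub>R ?v else axis i 1)"
    by (simp add: vec_eq_iff)
  finally show ?thesis
    by (simp only: det_identity_plus_rank_one_rows[of UNIV ?u ?v]) (simp add: mult.commute)
qed

section \<open>Integration and affine maps\<close>

lemma det_matrix_shear:
  assumes "m \<noteq> n"
  shows "det (matrix (\<lambda>x::real^'n. \<chi> i. if i = m then x $ m + x $ n else x $ i)) = 1"
proof -
  have "matrix (\<lambda>x::real^'n. \<chi> i. if i = m then x $ m + x $ n else x $ i) =
      (\<chi> k. if k = m then row m (mat 1) + 1 *s row n (mat 1) else row k (mat 1))"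
    by (auto simp: matrix_def row_def mat_def axis_def vec_eq_iff)
  then show ?thesis
    using det_row_operation[OF assms, of "mat 1 :: real^'n^'n" 1] by simp
qed

text \<open>
  Every linear map is a composition of singular maps, coordinate scalings, coordinate swaps and shears
  \<open>x\<^sub>m := x\<^sub>m + x\<^sub>n\<close>, and the claim is multiplicative. For swaps and shears it suffices to look at
  boxes, where both sides can be compared directly.
\<close>

lemma measure_linear_image_cart:
  fixes f :: "real^'n \<Rightarrow> real^'n"
  assumes "linear f" "S \<in> lmeasurable"
  shows "f ` S \<in> lmeasurable \<and> measure lebesgue (f ` S) = \<bar>det (matrix f)\<bar> * measure lebesgue S"
proof -
  let ?P = "\<lambda>f::real^'n \<Rightarrow> real^'n. \<forall>S \<in> lmeasurable.
      f ` S \<in> lmeasurable \<and> measure lebesgue (f ` S) = \<bar>det (matrix f)\<bar> * measure lebesgue S"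
  have "?P f"
    using \<open>linear f\<close>
  proof (rule induct_linear_elementary)
    fix f g :: "real^'n \<Rightarrow> real^'n"
    assume "linear f" "linear g" "?P f" "?P g"
    then show "?P (f \<circ> g)"
      by (simp add: matrix_compose det_mul abs_mult image_comp[symmetric] del: o_apply)
  next
    fix f :: "real^'n \<Rightarrow> real^'n" and i
    assume f: "linear f" "\<And>x. f x $ i = 0"
    then have "\<not> inj f"
      by (metis linear_injective_imp_surjective one_neq_zero surjE vec_component)
    then have "det (matrix f) = 0" "negligible (f ` S)" for S
      using f det_nz_iff_inj negligible_linear_singular_image by blast+
    then show "?P f"
      by (simp add: negligible_imp_measurable negligible_imp_measure0)
  next
    fix c :: "'n \<Rightarrow> real"
    show "?P (\<lambda>x. \<chi> i. c i * x $ i)"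
      by (simp add: measurable_stretch measure_stretch axis_def matrix_def det_diagonal)
  next
    fix m n :: 'n
    let ?h = "\<lambda>x::real^'n. \<chi> i. x $ Transposition.transpose m n i"
    have lin: "linear ?h" by (rule linearI) (simp_all add: vec_eq_iff)
    have box: "measure lebesgue (?h ` cbox a b) = 1 * measure lebesgue (cbox a b)" for a b
    proof (cases "cbox a b = {}")
      case False
      have "?h ` cbox a b = cbox (?h a) (?h b)"
      proof (intro equalityI subsetI)
        fix x assume "x \<in> cbox (?h a) (?h b)"
        then have "?h x \<in> cbox a b" unfolding mem_box_cart
          by (metis (no_types, lifting) transpose_involutory vec_lambda_beta)
        moreover have "x = ?h (?h x)" by (simp add: vec_eq_iff)
        ultimately show "x \<in> ?h ` cbox a b" by blast
      qed (auto simp: mem_box_cart)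
      moreover from this have "cbox (?h a) (?h b) \<noteq> {}" using False by blast
      moreover have "(\<Prod>i\<in>UNIV. b $ Transposition.transpose m n i - a $ Transposition.transpose m n i)
          = (\<Prod>i\<in>UNIV. b $ i - a $ i)"
        using prod.permute[OF permutes_swap_id[of m UNIV n], of "\<lambda>i. b $ i - a $ i"]
        by (simp add: o_def)
      ultimately show ?thesis using False by (simp add: content_cbox_cart)
    qed simp
    have det: "\<bar>det (matrix ?h)\<bar> = 1"
    proof -
      have "matrix ?h = (\<chi> i. mat 1 $ Transposition.transpose m n i)"
        by (auto simp: matrix_def mat_def axis_def vec_eq_iff)
      then show ?thesis
        by (simp add: det_permute_rows permutes_swap_id sign_swap_id)
    qed
    show "?P ?h"
      unfolding det using measure_linear_sufficient[OF lin _ box] by (blast intro: sym)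
  next
    fix m n :: 'n assume "m \<noteq> n"
    let ?h = "\<lambda>x::real^'n. \<chi> i. if i = m then x $ m + x $ n else x $ i"
    have lin: "linear ?h" by (rule linearI) (auto simp: vec_eq_iff algebra_simps)
    have box: "measure lebesgue (?h ` cbox a b) = 1 * measure lebesgue (cbox a b)" for a b
    proof (cases "cbox a b = {}")
      case False
      \<comment> \<open>translate the box so that its lower corner is the origin\<close>
      have shift: "cbox a b = (+) a ` cbox 0 (b - a)"
        using cbox_translation[of a 0 "b - a"] by simp
      then have "?h ` cbox a b = (+) (?h a) ` ?h ` cbox 0 (b - a)"
        by (simp add: image_image linear_add[OF lin])
      then have "measure lebesgue (?h ` cbox a b) = measure lebesgue (?h ` cbox 0 (b - a))"
        by (simp only: measure_translation)
      also have "\<dots> = measure lebesgue (cbox 0 (b - a))"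
        using False shift by (intro measure_shear_interval \<open>m \<noteq> n\<close>) auto
      also have "\<dots> = measure lebesgue (cbox a b)"
        unfolding shift by (simp only: measure_translation)
      finally show ?thesis by simp
    qed simp
    show "?P ?h"
      unfolding det_matrix_shear[OF \<open>m \<noteq> n\<close>] abs_one
      using measure_linear_sufficient[OF lin _ box] by (blast intro: sym)
  qed
  then show ?thesis using assms by blast
qed

lemma lborel_linear_bijection:
  fixes f :: "real^'n \<Rightarrow> real^'n"
  assumes f: "linear f" "inj f"
  shows "lborel = density (distr lborel borel f) (\<lambda>_. ennreal \<bar>det (matrix f)\<bar>)"
proof (rule lborel_eqI)
  fix l u :: "real^'n" assume lu: "\<And>b. b \<in> Basis \<Longrightarrow> l \<bullet> b \<le> u \<bullet> b"
  have [measurable]: "f \<in> borel_measurable borel"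
    using f by (simp add: linear_continuous_on borel_measurable_continuous_onI linear_conv_bounded_linear)
  obtain g where g: "linear g" "\<And>x. g (f x) = x" "\<And>x. f (g x) = x"
    using linear_injective_isomorphism[OF f] by blast
  have pre: "f -` box l u = g ` box l u"
    using g(2,3) by (auto simp: image_iff) metis
  have img: "f ` (f -` box l u) = box l u"
    unfolding pre by (simp add: image_image g(3))
  have meas: "f -` box l u \<in> lmeasurable"
    unfolding pre using measure_linear_image_cart[OF g(1)] by blast
  have "emeasure (density (distr lborel borel f) (\<lambda>_. ennreal \<bar>det (matrix f)\<bar>)) (box l u)
      = ennreal \<bar>det (matrix f)\<bar> * emeasure lborel (f -` box l u)"
    by (subst emeasure_density_const) (simp_all add: emeasure_distr)
  also have "emeasure lborel (f -` box l u) = emeasure lebesgue (f -` box l u)"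
    by (simp add: main_part_sets measurable_sets_borel[OF \<open>f \<in> borel_measurable borel\<close>])
  also have "\<dots> = measure lebesgue (f -` box l u)"
    using meas by (simp add: emeasure_eq_measure2)
  also have "ennreal \<bar>det (matrix f)\<bar> * \<dots> = ennreal (measure lebesgue (box l u))"
    using measure_linear_image_cart[OF f(1) meas] unfolding img
    by (simp add: ennreal_mult)
  also have "measure lebesgue (box l u) = (\<Prod>b\<in>Basis. (u - l) \<bullet> b)"
    using lu by (simp add: measure_lborel_box_eq)
  finally show "emeasure (density (distr lborel borel f) (\<lambda>_. ennreal \<bar>det (matrix f)\<bar>)) (box l u)
      = (\<Prod>b\<in>Basis. (u - l) \<bullet> b)"
    by (simp add: prod_ennreal)
qed simp

lemma has_integral_compact_lborel:
  fixes f :: "'a::euclidean_space \<Rightarrow> real"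
  assumes "compact K" "continuous_on K f"
  shows "(f has_integral (\<integral>x. indicator K x * f x \<partial>lborel)) K"
proof -
  have "set_integrable lborel K f"
    using borel_integrable_compact[OF assms] by (simp add: set_integrable_def)
  from set_borel_integral_eq_integral[OF this] show ?thesis
    by (simp add: has_integral_iff set_lebesgue_integral_def)
qed

text \<open>
  Singular maps are included: then both sides vanish, since the image is a null set. The tiling below
  relies on this, as some of its tiles may degenerate.
\<close>

lemma has_integral_affine_image:
  fixes f :: "real^'n \<Rightarrow> real^'n" and h :: "real^'n \<Rightarrow> real"
  assumes f: "linear f" and K: "compact K" and h: "continuous_on UNIV h"
  shows "(h has_integral \<bar>det (matrix f)\<bar> * integral K (\<lambda>x. h (f x + b))) ((\<lambda>x. f x + b) ` K)"
proof (cases "inj f")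
  case False
  then have "negligible ((+) b ` f ` K)"
    using f negligible_linear_singular_image negligible_translation by blast
  moreover have "(\<lambda>x. f x + b) ` K = (+) b ` f ` K" by (auto simp: image_image add.commute)
  moreover have "det (matrix f) = 0" using False f det_nz_iff_inj by blast
  ultimately show ?thesis using has_integral_negligible[of "(\<lambda>x. f x + b) ` K" "(\<lambda>x. f x + b) ` K" h] by simp
next
  case True
  let ?T = "\<lambda>x. f x + b" and ?d = "\<bar>det (matrix f)\<bar>"
  have contf: "continuous_on A f" for A
    using f by (simp add: linear_continuous_on linear_conv_bounded_linear)
  then have contT: "continuous_on A ?T" for A by (intro continuous_intros)
  have KT: "compact (?T ` K)" using contT K by (rule compact_continuous_image)
  have hT: "continuous_on A (\<lambda>x. h (?T x))" for A
    using continuous_on_compose2[OF h contT] by simp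
  have [measurable]: "f \<in> borel_measurable borel" "h \<in> borel_measurable borel"
    using contf h by (auto intro: borel_measurable_continuous_onI)
  have [measurable]: "?T ` K \<in> sets borel" using KT by (rule borel_compact)
  have inK: "indicator (?T ` K) (?T x) = (indicator K x :: real)" for x
  proof -
    have "?T x \<in> ?T ` K \<longleftrightarrow> x \<in> K"
      using True by (intro inj_image_mem_iff) (simp add: inj_def)
    then show ?thesis by (simp add: indicator_def)
  qed
  have "(\<integral>y. indicator (?T ` K) y * h y \<partial>lborel) = (\<integral>y. indicator (?T ` K) y * h y \<partial>distr lborel borel ((+) b))"
    by (simp add: lborel_distr_plus)
  also have "\<dots> = (\<integral>y. indicator (?T ` K) (b + y) * h (b + y) \<partial>lborel)"
    by (subst integral_distr) simp_all
  also have "\<dots> = (\<integral>y. indicator (?T ` K) (b + y) * h (b + y) \<partial>density (distr lborel borel f) (\<lambda>_. ennreal ?d))"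
    using lborel_linear_bijection[OF f True] by simp
  also have "\<dots> = (\<integral>y. ?d *\<^sub>R (indicator (?T ` K) (b + y) * h (b + y)) \<partial>distr lborel borel f)"
    by (subst integral_density) simp_all
  also have "\<dots> = (\<integral>x. ?d *\<^sub>R (indicator (?T ` K) (b + f x) * h (b + f x)) \<partial>lborel)"
    by (subst integral_distr) simp_all
  also have "\<dots> = ?d * (\<integral>x. indicator K x * h (f x + b) \<partial>lborel)"
    using inK by (simp add: add.commute[of b])
  also have "(\<integral>x. indicator K x * h (f x + b) \<partial>lborel) = integral K (\<lambda>x. h (f x + b))"
    using has_integral_compact_lborel[OF K hT] by (simp add: integral_unique)
  finally show ?thesis
    using has_integral_compact_lborel[OF KT continuous_on_subset[OF h]] by simp
qed

lemma integral_uniform_measure_compact: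
  fixes h :: "'a::euclidean_space \<Rightarrow> real"
  assumes K: "compact K" and pos: "0 < measure lborel K" and h: "continuous_on UNIV h"
  shows "(\<integral>x. h x \<partial>uniform_measure lborel K) = integral K h / measure lborel K"
proof -
  have [measurable]: "h \<in> borel_measurable borel" using h by (rule borel_measurable_continuous_onI)
  have [measurable]: "K \<in> sets borel" using K by (rule borel_compact)
  have em: "emeasure lborel K = ennreal (measure lborel K)"
    using emeasure_compact_finite[OF K] by (simp add: emeasure_eq_ennreal_measure)
  have "uniform_measure lborel K = density lborel (\<lambda>x. ennreal (indicator K x / measure lborel K))"
    unfolding uniform_measure_def em
    by (intro density_cong AE_I2) (use pos in \<open>auto simp: divide_ennreal simp flip: ennreal_indicator\<close>)
  then have "(\<integral>x. h x \<partial>uniform_measure lborel K)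
      = (\<integral>x. (indicator K x / measure lborel K) *\<^sub>R h x \<partial>lborel)"
    by (simp add: integral_density)
  also have "\<dots> = (\<integral>x. indicator K x * h x \<partial>lborel) / measure lborel K"
    by simp
  also have "(\<integral>x. indicator K x * h x \<partial>lborel) = integral K h"
    using has_integral_compact_lborel[OF K continuous_on_subset[OF h]] by (simp add: integral_unique)
  finally show ?thesis .
qed

section \<open>Affine invariance of the isotropic constant\<close>

lemma affine_image_moments:
  fixes f :: "real^'n \<Rightarrow> real^'n" and b :: "real^'n"
  assumes f: "linear f" and K: "compact K"
  defines "T \<equiv> (\<lambda>x. f x + b) ` K" and "M \<equiv> matrix f" and "V \<equiv> measure lborel K"
  defines "\<mu> \<equiv> \<lambda>i. integral K (\<lambda>x. x $ i)"
  shows "((\<lambda>x. 1) has_integral \<bar>det M\<bar> * V) T"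
    and "((\<lambda>x. x $ i) has_integral \<bar>det M\<bar> * ((\<Sum>k\<in>UNIV. M $ i $ k * \<mu> k) + V * b $ i)) T"
    and "((\<lambda>x. x $ i * x $ j) has_integral \<bar>det M\<bar> *
      ((\<Sum>k\<in>UNIV. \<Sum>l\<in>UNIV. M $ i $ k * M $ j $ l * integral K (\<lambda>x. x $ k * x $ l))
       + b $ j * (\<Sum>k\<in>UNIV. M $ i $ k * \<mu> k) + b $ i * (\<Sum>l\<in>UNIV. M $ j $ l * \<mu> l)
       + V * (b $ i * b $ j))) T"
proof -
  have int: "(h has_integral integral K h) K" if "continuous_on UNIV h" for h :: "real^'n \<Rightarrow> real"
    using has_integral_compact_lborel[OF K continuous_on_subset[OF that subset_UNIV]]
    by (meson has_integral_integrable integrable_integral)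
  have image: "(h has_integral \<bar>det M\<bar> * c) T"
    if "continuous_on UNIV h" "((\<lambda>x. h (f x + b)) has_integral c) K" for h :: "real^'n \<Rightarrow> real" and c
    using has_integral_affine_image[OF f K that(1), of b] that(2)
    unfolding T_def M_def by (simp add: integral_unique)
  have const: "((\<lambda>x. c) has_integral V * c) K" for c :: real
  proof -
    have "((\<lambda>x::real^'n. 1) has_integral V) K"
      using has_integral_compact_lborel[OF K continuous_on_const[of K "1::real"]] K
      by (simp add: V_def borel_compact)
    from has_integral_mult_left[OF this, of c] show ?thesis by simp
  qed
  have comp: "(f x + b) $ i = (\<Sum>k\<in>UNIV. M $ i $ k * x $ k) + b $ i" for x i
  proof -
    have "f x = M *v x" using matrix_works f by (simp add: M_def)
    then show ?thesis by (simp add: matrix_vector_mult_def)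
  qed
  have lin: "((\<lambda>x. \<Sum>k\<in>UNIV. M $ i $ k * x $ k) has_integral (\<Sum>k\<in>UNIV. M $ i $ k * \<mu> k)) K" for i
    unfolding \<mu>_def
    by (intro has_integral_sum has_integral_mult_right int continuous_intros) simp
  show "((\<lambda>x. 1) has_integral \<bar>det M\<bar> * V) T"
    using image[of "\<lambda>x. 1" V] const[of 1] by simp
  show "((\<lambda>x. x $ i) has_integral \<bar>det M\<bar> * ((\<Sum>k\<in>UNIV. M $ i $ k * \<mu> k) + V * b $ i)) T"
    by (rule image) (auto simp only: comp intro!: continuous_intros has_integral_add lin const)
  have "((\<lambda>x. (\<Sum>k\<in>UNIV. \<Sum>l\<in>UNIV. M $ i $ k * M $ j $ l * (x $ k * x $ l))
       + b $ j * (\<Sum>k\<in>UNIV. M $ i $ k * x $ k) + b $ i * (\<Sum>l\<in>UNIV. M $ j $ l * x $ l)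
       + b $ i * b $ j) has_integral
      (\<Sum>k\<in>UNIV. \<Sum>l\<in>UNIV. M $ i $ k * M $ j $ l * integral K (\<lambda>x. x $ k * x $ l))
       + b $ j * (\<Sum>k\<in>UNIV. M $ i $ k * \<mu> k) + b $ i * (\<Sum>l\<in>UNIV. M $ j $ l * \<mu> l)
       + V * (b $ i * b $ j)) K"
    by (intro has_integral_add has_integral_sum has_integral_mult_right int lin const continuous_intros) simp_all
  moreover have "(f x + b) $ i * (f x + b) $ j =
      (\<Sum>k\<in>UNIV. \<Sum>l\<in>UNIV. M $ i $ k * M $ j $ l * (x $ k * x $ l))
       + b $ j * (\<Sum>k\<in>UNIV. M $ i $ k * x $ k) + b $ i * (\<Sum>l\<in>UNIV. M $ j $ l * x $ l)
       + b $ i * b $ j" for x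
  proof -
    have "(\<Sum>k\<in>UNIV. \<Sum>l\<in>UNIV. M $ i $ k * M $ j $ l * (x $ k * x $ l)) =
        (\<Sum>k\<in>UNIV. M $ i $ k * x $ k) * (\<Sum>l\<in>UNIV. M $ j $ l * x $ l)"
      by (simp add: sum_product mult_ac)
    then show ?thesis unfolding comp by (simp add: algebra_simps)
  qed
  ultimately show "((\<lambda>x. x $ i * x $ j) has_integral \<bar>det M\<bar> *
      ((\<Sum>k\<in>UNIV. \<Sum>l\<in>UNIV. M $ i $ k * M $ j $ l * integral K (\<lambda>x. x $ k * x $ l))
       + b $ j * (\<Sum>k\<in>UNIV. M $ i $ k * \<mu> k) + b $ i * (\<Sum>l\<in>UNIV. M $ j $ l * \<mu> l)
       + V * (b $ i * b $ j))) T"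
    by (intro image continuous_intros) simp
qed

lemma measure_eq_integral_one:
  assumes "compact K" "((\<lambda>x::'a::euclidean_space. 1::real) has_integral v) K"
  shows "measure lborel K = v"
proof -
  have "((\<lambda>x::'a. 1::real) has_integral measure lborel K) K"
    using has_integral_compact_lborel[OF assms(1) continuous_on_const[of K "1::real"]] assms(1)
    by (simp add: borel_compact)
  then show ?thesis using assms(2) by (rule has_integral_unique)
qed

lemma covariance_matrix_nth:
  fixes K :: "(real^'n) set"
  assumes "compact K" "0 < measure lborel K"
  shows "covariance_matrix K $ i $ j =
    integral K (\<lambda>x. x $ i * x $ j) / measure lborel K
    - integral K (\<lambda>x. x $ i) / measure lborel K * (integral K (\<lambda>x. x $ j) / measure lborel K)"
proof -
  note E = integral_uniform_measure_compact[OF assms]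
  have "(\<integral>x. x $ i * x $ j \<partial>uniform_measure lborel K) = integral K (\<lambda>x. x $ i * x $ j) / measure lborel K"
    by (rule E) (intro continuous_intros)
  moreover have "(\<integral>x. x $ i \<partial>uniform_measure lborel K) = integral K (\<lambda>x. x $ i) / measure lborel K" for i
    by (rule E) (intro continuous_intros)
  ultimately show ?thesis
    by (simp add: covariance_matrix_def mean_vector_def second_moment_matrix_def)
qed

text \<open>
  If \<open>M\<close> is the matrix of the linear part, the covariance matrix turns into \<open>M A M\<^sup>T\<close>, so that both its
  determinant and the square of the volume are multiplied by \<open>(det M)\<^sup>2\<close>.
\<close>

lemma isotropic_constant_affine_invariant:
  fixes K :: "(real^'n) set" and f :: "real^'n \<Rightarrow> real^'n"
  assumes f: "linear f" "bij f" and K: "compact K" "0 < measure lborel K"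
  shows "isotropic_constant ((\<lambda>x. f x + b) ` K) = isotropic_constant K"
proof -
  define T where "T = (\<lambda>x. f x + b) ` K"
  define M where "M = matrix f"
  define V where "V = measure lborel K"
  define d where "d = \<bar>det M\<bar>"
  note moments = affine_image_moments[OF f(1) K(1), where b = b,
      folded T_def M_def V_def, folded d_def]
  have "det M \<noteq> 0"
    using f det_nz_iff_inj[OF f(1)] by (simp add: M_def bij_is_inj)
  then have d: "0 < d" by (simp add: d_def)
  have V: "0 < V" using K by (simp add: V_def)
  have "continuous_on K (\<lambda>x. f x + b)"
    using f by (intro continuous_intros) (simp add: linear_continuous_on linear_conv_bounded_linear)
  then have T: "compact T"
    unfolding T_def using K(1) by (rule compact_continuous_image)
  have volT: "measure lborel T = d * V"
    using T moments(1) by (rule measure_eq_integral_one)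
  then have Tpos: "0 < measure lborel T" using d V by simp
  let ?C = "covariance_matrix K"
  have "covariance_matrix T $ i $ j = (M ** ?C ** transpose M) $ i $ j" for i j
  proof -
    let ?m = "\<lambda>k. integral K (\<lambda>x. x $ k)" and ?s = "\<lambda>k l. integral K (\<lambda>x. x $ k * x $ l)"
    let ?A = "\<lambda>i. \<Sum>k\<in>UNIV. M $ i $ k * ?m k"
    let ?S = "\<Sum>k\<in>UNIV. \<Sum>l\<in>UNIV. M $ i $ k * M $ j $ l * ?s k l"
    have "(M ** ?C ** transpose M) $ i $ j = (\<Sum>l\<in>UNIV. \<Sum>k\<in>UNIV. M $ i $ k * M $ j $ l * ?C $ k $ l)"
      by (simp add: matrix_matrix_mult_def transpose_def sum_distrib_left sum_distrib_right mult_ac)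
    also have "\<dots> = (\<Sum>k\<in>UNIV. \<Sum>l\<in>UNIV. M $ i $ k * M $ j $ l * ?C $ k $ l)"
      by (rule sum.swap)
    also have "\<dots> = (\<Sum>k\<in>UNIV. \<Sum>l\<in>UNIV. M $ i $ k * M $ j $ l * ?s k l / V
          - (M $ i $ k * ?m k / V) * (M $ j $ l * ?m l / V))"
      unfolding covariance_matrix_nth[OF K] V_def
      by (simp add: right_diff_distrib mult_ac)
    also have "\<dots> = ?S / V - ?A i / V * (?A j / V)"
      by (simp only: sum_subtractf sum_product sum_divide_distrib)
    finally have C: "(M ** ?C ** transpose M) $ i $ j = ?S / V - ?A i / V * (?A j / V)" .
    have "covariance_matrix T $ i $ j = d * (?S + b $ j * ?A i + b $ i * ?A j + V * (b $ i * b $ j)) / (d * V)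
        - d * (?A i + V * b $ i) / (d * V) * (d * (?A j + V * b $ j) / (d * V))"
      unfolding covariance_matrix_nth[OF T Tpos] volT
        moments(2,3)[THEN integral_unique] by (rule refl)
    also have "\<dots> = ?S / V - ?A i / V * (?A j / V)"
      using d V by (simp add: field_simps)
    finally show ?thesis using C by simp
  qed
  then have "covariance_matrix T = M ** ?C ** transpose M" by (simp add: vec_eq_iff)
  then have "det (covariance_matrix T) = d\<^sup>2 * det ?C"
    by (simp add: det_mul d_def power2_eq_square)
  then show ?thesis
    using d unfolding isotropic_constant_def T_def[symmetric] volT V_def[symmetric]
    by (simp add: power_mult_distrib)
qed

section \<open>Moments of the cube\<close>

text \<open>
  The hyperplane \<open>x $ i = 0\<close> cuts the cube into two halves, each of which is an affine copy of the cube: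
  coordinate \<open>i\<close> is halved and then shifted by \<open>1 / 2\<close> or \<open>- 1 / 2\<close>. Expressing the moments of the halves
  through those of the cube gives linear equations that determine them: \<open>m = m / 2\<close> for the
  first moments and for the mixed ones, and \<open>s = (s + 2\<^sup>n) / 4\<close> for the integral of \<open>(x $ i)\<^sup>2\<close>.
\<close>

lemma cube_moments:
  fixes i j :: "'n::finite"
  defines "C \<equiv> cbox (- 1) (1 :: real^'n)"
  shows "measure lborel C = 2 ^ CARD('n)"
    and "integral C (\<lambda>x. x $ i) = 0"
    and "integral C (\<lambda>x. x $ i * x $ j) = (if i = j then 2 ^ CARD('n) / 3 else 0)"
proof -
  have C: "compact C" by (simp add: C_def)
  show vol: "measure lborel C = 2 ^ CARD('n)"
    by (subst measure_completion[symmetric]) (simp_all add: C_def content_cbox_cart interval_ne_empty_cart)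
  define half :: "real^'n \<Rightarrow> real^'n" where "half = (\<lambda>x. \<chi> k. (if k = i then 1 / 2 else 1) * x $ k)"
  define T where "T s = (\<lambda>x. half x + axis i (s / 2)) ` C" for s :: real
  have lin: "linear half" by (rule linearI) (simp_all add: half_def vec_eq_iff algebra_simps)
  have M: "matrix half = (\<chi> p q. if p = q then if p = i then 1 / 2 else 1 else 0)"
    by (auto simp: half_def matrix_def vec_eq_iff axis_def)
  have det: "\<bar>det (matrix half)\<bar> = 1 / 2"
    unfolding M by (subst det_diagonal) (auto simp: prod.remove[of UNIV i])
  have slab: "T s = {x \<in> C. s * x $ i \<ge> 0}" if "s = 1 \<or> s = -1" for s
  proof (intro equalityI subsetI)
    fix x assume "x \<in> {x \<in> C. s * x $ i \<ge> 0}"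
    then have x: "\<And>k. -1 \<le> x $ k \<and> x $ k \<le> 1" "s * x $ i \<ge> 0" by (auto simp: C_def mem_box_cart)
    let ?y = "\<chi> k. if k = i then 2 * x $ i - s else x $ k"
    have "?y \<in> C" using x that by (auto simp: C_def mem_box_cart) (use x(1)[of i] in linarith)+
    moreover have "x = half ?y + axis i (s / 2)"
      by (simp add: half_def vec_eq_iff axis_def field_simps)
    ultimately show "x \<in> T s" unfolding T_def by blast
  next
    fix x assume "x \<in> T s"
    then obtain z where z: "z \<in> C" "x = half z + axis i (s / 2)" by (auto simp: T_def)
    then have x: "x $ k = (if k = i then (z $ i + s) / 2 else z $ k)" for k
      by (simp add: half_def axis_def field_simps)
    have "- 1 \<le> z $ k" "z $ k \<le> 1" for k using z(1) by (simp_all add: C_def mem_box_cart)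
    moreover from this[of i] have "- 1 \<le> x $ i" "x $ i \<le> 1" "0 \<le> s * x $ i"
      using that by (auto simp: x)
    ultimately show "x \<in> {x \<in> C. s * x $ i \<ge> 0}"
      by (auto simp: C_def mem_box_cart x)
  qed
  have split: "integral C h = p + q"
    if "(h has_integral p) (T 1)" "(h has_integral q) (T (-1))" for h :: "real^'n \<Rightarrow> real" and p q
  proof -
    have "T 1 \<inter> T (-1) \<subseteq> {x. x $ i = 0}" by (auto simp: slab)
    then have "negligible (T 1 \<inter> T (-1))"
      using negligible_standard_hyperplane_cart negligible_subset by blast
    then have "(h has_integral p + q) (T 1 \<union> T (-1))" using that by (intro has_integral_Un)
    moreover have "T 1 \<union> T (-1) = C" by (auto simp: slab)
    ultimately show ?thesis by (simp add: integral_unique)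
  qed
  have M_sum: "(\<Sum>l\<in>UNIV. matrix half $ p $ l * g l) = (if p = i then 1 / 2 else 1) * g p" for p g
    unfolding M by (subst sum.cong[OF refl, of _ _ "\<lambda>l. if l = p then (if p = i then 1 / 2 else 1) * g l else 0"]) auto
  have M_sum2: "(\<Sum>k\<in>UNIV. \<Sum>l\<in>UNIV. matrix half $ p $ k * matrix half $ q $ l * g k l) =
      (if p = i then 1 / 2 else 1) * ((if q = i then 1 / 2 else 1) * g p q)" for p q g
    by (simp only: mult.assoc sum_distrib_left[symmetric] M_sum)
  note upper = affine_image_moments[OF lin C, where b = "axis i (1 / 2)",
      folded T_def[of 1], unfolded det M_sum M_sum2 vol]
  note lower = affine_image_moments[OF lin C, where b = "axis i (- 1 / 2)",
      folded T_def[of "- 1"], unfolded det M_sum M_sum2 vol]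
  let ?m = "integral C (\<lambda>x. x $ i)" and ?s = "integral C (\<lambda>x. x $ i * x $ j)"
  have "?m = (?m / 2 + N / 2) / 2 + (?m / 2 - N / 2) / 2" if "N = 2 ^ CARD('n)" for N :: real
    using split[OF upper(2)[of i] lower(2)[of i]] by (simp add: axis_def that)
  then show m: "?m = 0" by (simp add: field_simps)
  show "?s = (if i = j then 2 ^ CARD('n) / 3 else 0)"
  proof (cases "i = j")
    case True
    have "?s = (?s + 2 ^ CARD('n)) / 4"
      using split[OF upper(3)[of i j] lower(3)[of i j]] True m
      by (simp add: axis_def field_simps)
    then show ?thesis using True by simp
  next
    case False
    have "?s = ?s / 2"
      using split[OF upper(3)[of i j] lower(3)[of i j]] False
      by (simp add: axis_def field_simps)
    then show ?thesis using False by simp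
  qed
qed

section \<open>Tiling a cube with one additional generator\<close>

definition cube_zonotope :: "real^'n \<Rightarrow> (real^'n) set" where
  "cube_zonotope a = cbox (- 1) 1 + closed_segment (- a) a"

text \<open>
  The linear map that sends the basis vector \<open>axis i 1\<close> to \<open>a\<close> and fixes the others.
\<close>

definition replace_axis :: "real^'n \<Rightarrow> 'n \<Rightarrow> real^'n \<Rightarrow> real^'n" where
  "replace_axis a i x = (\<chi> j. (if j = i then 0 else x $ j) + x $ i * a $ j)"

text \<open>
  The tiles are indexed by the generators, \<open>None\<close> standing for \<open>a\<close>. Each one is the sum of the
  segments of all other generators, translated to the boundary: tile \<open>None\<close> is the cube pushed to the far
  end of \<open>[-a, a]\<close>, and tile \<open>Some i\<close> is swept out by the facet \<open>x $ i = - 1\<close> of the cube as it moves along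
  \<open>[-a, a]\<close>. The latter is written as an affine image of the full cube in which coordinate
  \<open>i\<close> serves as the parameter of the movement.
\<close>

definition tile :: "real^'n \<Rightarrow> 'n option \<Rightarrow> (real^'n) set" where
  "tile a s = (case s of
      None \<Rightarrow> (\<lambda>x. x + a) ` cbox (- 1) 1
    | Some i \<Rightarrow> (\<lambda>x. replace_axis a i x + - axis i 1) ` cbox (- 1) 1)"

lemma sum_UNIV_option: "(\<Sum>s\<in>UNIV. g s) = g None + (\<Sum>i\<in>UNIV. g (Some i))"
  for g :: "'n::finite option \<Rightarrow> 'b::comm_monoid_add"
  by (simp add: UNIV_option_conv sum.reindex)

lemma prod_UNIV_option: "(\<Prod>s\<in>UNIV. g s) = g None * (\<Prod>i\<in>UNIV. g (Some i))"
  for g :: "'n::finite option \<Rightarrow> 'b::comm_monoid_mult"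
  by (simp add: UNIV_option_conv prod.reindex)

lemma in_closed_segment_symmetric:
  fixes z :: "'a::real_vector"
  shows "x \<in> closed_segment (- z) z \<longleftrightarrow> (\<exists>t. \<bar>t\<bar> \<le> 1 \<and> x = t *\<^sub>R z)"
proof
  assume "x \<in> closed_segment (- z) z"
  then obtain u where "0 \<le> u" "u \<le> 1" "x = (1 - u) *\<^sub>R (- z) + u *\<^sub>R z"
    by (auto simp: in_segment)
  then have "\<bar>2 * u - 1\<bar> \<le> 1" "x = (2 * u - 1) *\<^sub>R z" by (auto simp: algebra_simps simp flip: scaleR_2)
  then show "\<exists>t. \<bar>t\<bar> \<le> 1 \<and> x = t *\<^sub>R z" by blast
next
  assume "\<exists>t. \<bar>t\<bar> \<le> 1 \<and> x = t *\<^sub>R z"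
  then obtain t where t: "\<bar>t\<bar> \<le> 1" "x = t *\<^sub>R z" by blast
  then have "x = (1 - (1 + t) / 2) *\<^sub>R (- z) + ((1 + t) / 2) *\<^sub>R z"
    by (simp add: algebra_simps flip: scaleR_left_distrib) (simp add: field_simps flip: scaleR_diff_left)
  moreover have "0 \<le> (1 + t) / 2" "(1 + t) / 2 \<le> 1" using t by (auto simp: abs_le_iff)
  ultimately show "x \<in> closed_segment (- z) z" unfolding in_segment by blast
qed

lemma in_cube_zonotope:
  "x \<in> cube_zonotope a \<longleftrightarrow> (\<exists>y\<in>cbox (- 1) 1. \<exists>t. \<bar>t\<bar> \<le> 1 \<and> x = y + t *\<^sub>R a)"
  unfolding cube_zonotope_def set_plus_def in_closed_segment_symmetric mem_Collect_eq Bex_def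
  by blast

lemma in_tile_Some:
  "x \<in> tile a (Some i) \<longleftrightarrow>
    (\<exists>y\<in>cbox (- 1) 1. \<exists>t. \<bar>t\<bar> \<le> 1 \<and> y $ i = - 1 \<and> x = y + t *\<^sub>R a)"
proof
  assume "x \<in> tile a (Some i)"
  then obtain z where z: "z \<in> cbox (- 1) 1" "x = replace_axis a i z + - axis i 1"
    by (auto simp: tile_def)
  let ?y = "\<chi> j. if j = i then - 1 else z $ j"
  have "?y \<in> cbox (- 1) 1" using z(1) by (simp add: mem_box_cart)
  moreover have "\<bar>z $ i\<bar> \<le> 1" using z(1) by (simp add: mem_box_cart abs_le_iff minus_le_iff)
  moreover have "x = ?y + z $ i *\<^sub>R a"
    unfolding z(2) by (simp add: replace_axis_def vec_eq_iff axis_def)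
  ultimately show "\<exists>y\<in>cbox (- 1) 1. \<exists>t. \<bar>t\<bar> \<le> 1 \<and> y $ i = - 1 \<and> x = y + t *\<^sub>R a"
    by (intro bexI[of _ ?y] exI[of _ "z $ i"]) auto
next
  assume "\<exists>y\<in>cbox (- 1) 1. \<exists>t. \<bar>t\<bar> \<le> 1 \<and> y $ i = - 1 \<and> x = y + t *\<^sub>R a"
  then obtain y t where y: "y \<in> cbox (- 1) 1" "\<bar>t\<bar> \<le> 1" "y $ i = - 1" "x = y + t *\<^sub>R a" by blast
  let ?z = "\<chi> j. if j = i then t else y $ j"
  have "?z \<in> cbox (- 1) 1" using y(1,2) by (simp add: mem_box_cart abs_le_iff)
  moreover have "x = replace_axis a i ?z + - axis i 1"
    using y(3,4) by (simp add: replace_axis_def vec_eq_iff axis_def)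
  ultimately show "x \<in> tile a (Some i)" by (auto simp: tile_def)
qed

text \<open>
  Write a point as \<open>y + t a\<close> with \<open>y\<close> in the cube and with \<open>t \<le> 1\<close> as large as possible. Either \<open>t = 1\<close>, or
  \<open>t\<close> cannot be increased because \<open>y\<close> would leave the cube; since \<open>a\<close> is nonnegative, this happens through
  a facet \<open>y $ i = - 1\<close>.
\<close>

lemma cube_zonotope_eq_Union_tiles:
  assumes "\<And>i. 0 \<le> a $ i"
  shows "cube_zonotope a = (\<Union>s. tile a s)"
proof (intro equalityI subsetI)
  fix x assume "x \<in> (\<Union>s. tile a s)"
  then obtain s where s: "x \<in> tile a s" by blast
  show "x \<in> cube_zonotope a"
  proof (cases s)
    case None
    then obtain y where y: "y \<in> cbox (- 1) 1" "x = y + 1 *\<^sub>R a" using s by (auto simp: tile_def)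
    show ?thesis unfolding in_cube_zonotope
      by (rule bexI[OF _ y(1)], rule exI[of _ 1]) (simp add: y(2))
  next
    case (Some i)
    then show ?thesis using s unfolding Some in_tile_Some in_cube_zonotope by blast
  qed
next
  fix x assume x: "x \<in> cube_zonotope a"
  let ?S = "{t \<in> {-1..1}. x - t *\<^sub>R a \<in> cbox (- 1) 1}"
  have "closed ((\<lambda>t. x - t *\<^sub>R a) -` cbox (- 1) 1)"
    by (intro closed_vimage closed_cbox continuous_intros)
  then have "compact ({-1..1} \<inter> (\<lambda>t. x - t *\<^sub>R a) -` cbox (- 1) 1)"
    by (intro compact_Int_closed) simp_all
  then have "compact ?S" by (simp add: Int_def)
  moreover from x have "?S \<noteq> {}"
    unfolding in_cube_zonotope by (fastforce simp: abs_le_iff)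
  ultimately obtain t where t: "t \<in> ?S" and max: "\<And>u. u \<in> ?S \<Longrightarrow> u \<le> t"
    using compact_attains_sup[of ?S] by blast
  define y where "y = x - t *\<^sub>R a"
  have y: "y \<in> cbox (- 1) 1" "x = y + t *\<^sub>R a" and t1: "\<bar>t\<bar> \<le> 1" using t by (auto simp: y_def)
  then have bound: "- 1 \<le> y $ i" "y $ i \<le> 1" for i by (auto simp: mem_box_cart)
  show "x \<in> (\<Union>s. tile a s)"
  proof (cases "t = 1 \<or> (\<exists>i. y $ i = - 1)")
    case True
    then consider "t = 1" | i where "y $ i = - 1" by blast
    then show ?thesis
    proof cases
      case 1
      then have "x \<in> tile a None" using y by (simp add: tile_def)
      then show ?thesis by blast
    next
      case (2 i)
      then have "x \<in> tile a (Some i)" using y t1 unfolding in_tile_Some by blast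
      then show ?thesis by blast
    qed
  next
    case False
    then have "t < 1" "- 1 < y $ i" for i using t1 bound[of i] by (auto simp: less_le)
    \<comment> \<open>no coordinate blocks the way, so the parameter could be increased\<close>
    define \<epsilon> where "\<epsilon> = min (1 - t) (Min (range (\<lambda>i. (y $ i + 1) / (1 + a $ i))))"
    have "0 < (y $ i + 1) / (1 + a $ i)" for i
      using \<open>- 1 < y $ i\<close> assms[of i] by (intro divide_pos_pos) linarith+
    then have "0 < \<epsilon>" using \<open>t < 1\<close> by (simp add: \<epsilon>_def)
    have "\<epsilon> * a $ i \<le> y $ i + 1" for i
    proof -
      have "\<epsilon> \<le> (y $ i + 1) / (1 + a $ i)" unfolding \<epsilon>_def by (simp add: min.coboundedI2)
      then have "\<epsilon> * (1 + a $ i) \<le> y $ i + 1" using assms[of i] by (simp add: le_divide_eq)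
      then show ?thesis using \<open>0 < \<epsilon>\<close> by (simp add: algebra_simps)
    qed
    moreover have "0 \<le> \<epsilon> * a $ i" for i using \<open>0 < \<epsilon>\<close> assms by simp
    ultimately have "y - \<epsilon> *\<^sub>R a \<in> cbox (- 1) 1"
      using bound by (auto simp: mem_box_cart algebra_simps) (smt (verit))+
    moreover have "x - (t + \<epsilon>) *\<^sub>R a = y - \<epsilon> *\<^sub>R a" by (simp add: y_def algebra_simps)
    moreover have "t + \<epsilon> \<le> 1" by (simp add: \<epsilon>_def)
    ultimately have "t + \<epsilon> \<in> ?S" using t1 \<open>0 < \<epsilon>\<close> by auto
    then show ?thesis using max \<open>0 < \<epsilon>\<close> by force
  qed
qed

lemma linear_replace_axis: "linear (replace_axis a i)"
  by (rule linearI) (auto simp: replace_axis_def vec_eq_iff algebra_simps)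

lemma matrix_replace_axis:
  "matrix (replace_axis a i) = (\<chi> p q. if q = i then a $ p else mat 1 $ p $ q)"
  by (auto simp: matrix_def replace_axis_def vec_eq_iff axis_def mat_def)

lemma det_matrix_replace_axis: "det (matrix (replace_axis a i)) = a $ i"
  using cramer_lemma[where A = "mat 1" and k = i and x = a, unfolded matrix_vector_mul_lid]
  by (simp add: matrix_replace_axis)

lemma negligible_affine_image_cart:
  fixes f :: "real^'n \<Rightarrow> real^'n"
  assumes "linear f" "negligible S"
  shows "negligible ((\<lambda>x. f x + b) ` S)"
proof -
  have "negligible (f ` S)"
    using measure_linear_image_cart[OF assms(1)] assms(2) by (simp add: negligible_iff_measure)
  then have "negligible ((+) b ` f ` S)" by (rule negligible_translation)
  then show ?thesis by (simp add: image_image add.commute)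
qed

lemma negligible_tile_face:
  fixes a :: "real^'n"
  shows "negligible ((\<lambda>x. replace_axis a i x + - axis i 1) ` {x. x $ j = c})"
proof -
  have "negligible {x :: real^'n. axis j 1 \<bullet> x = c}"
    by (rule negligible_hyperplane) (simp add: axis_eq_0_iff)
  then show ?thesis
    by (intro negligible_affine_image_cart linear_replace_axis) (simp add: inner_axis')
qed

text \<open>
  If \<open>a $ i = 0\<close>, tile \<open>Some i\<close> is flat. Otherwise the parameter \<open>t\<close> of a point of that tile is the largest
  admissible one, hence determined by the point. So the descriptions of a common point of two tiles
  agree, and the conditions of both tiles on them confine the point to the image of a facet of the cube.
\<close>

lemma pairwise_negligible_tiles:
  assumes "\<And>i. 0 \<le> a $ i"
  shows "pairwise (\<lambda>s t. negligible (tile a s \<inter> tile a t)) UNIV"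
proof -
  have flat: "negligible (tile a (Some i))" if "a $ i = 0" for i
  proof -
    have "\<not> inj (replace_axis a i)"
      using det_nz_iff_inj[OF linear_replace_axis, of a i] that by (simp add: det_matrix_replace_axis)
    then have "negligible ((+) (- axis i 1) ` replace_axis a i ` cbox (- 1) 1)"
      by (intro negligible_translation negligible_linear_singular_image linear_replace_axis)
    then show ?thesis by (simp add: tile_def image_image add.commute)
  qed
  have top: "negligible (tile a None \<inter> tile a (Some i))" for i
  proof (cases "a $ i = 0")
    case True
    then show ?thesis using flat by (simp add: negligible_Int)
  next
    case False
    then have ai: "0 < a $ i" using assms[of i] by simp
    have "x \<in> (\<lambda>x. replace_axis a i x + - axis i 1) ` {x. x $ i = 1}"
      if "x \<in> tile a None" "x \<in> tile a (Some i)" for x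
    proof -
      from that(1) obtain y where y: "y \<in> cbox (- 1) 1" "x = y + a" by (auto simp: tile_def)
      from that(2) obtain y' t where y': "\<bar>t\<bar> \<le> 1" "y' $ i = - 1" "x = y' + t *\<^sub>R a"
        unfolding in_tile_Some by blast
      have "- 1 \<le> y $ i" using y(1) by (simp add: mem_box_cart)
      moreover have "y $ i + (1 - t) * a $ i = - 1"
        using arg_cong[OF y(2), of "\<lambda>v. v $ i"] arg_cong[OF y'(3), of "\<lambda>v. v $ i"] y'(2)
        by (simp add: algebra_simps)
      moreover have "0 \<le> (1 - t) * a $ i" using y'(1) ai by simp
      ultimately have "(1 - t) * a $ i = 0" by linarith
      then have "t = 1" using ai by simp
      then have "x = replace_axis a i (\<chi> j. if j = i then 1 else y' $ j) + - axis i 1"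
        using y'(2,3) by (simp add: replace_axis_def vec_eq_iff axis_def)
      moreover have "(\<chi> j. if j = i then 1 else y' $ j) \<in> {x. x $ i = 1}" by simp
      ultimately show ?thesis by blast
    qed
    then show ?thesis by (intro negligible_subset[OF negligible_tile_face]) auto
  qed
  have side: "negligible (tile a (Some i) \<inter> tile a (Some j))" if "i \<noteq> j" for i j
  proof (cases "a $ i = 0 \<or> a $ j = 0")
    case True
    then show ?thesis using flat by (auto intro: negligible_Int)
  next
    case False
    then have ai: "0 < a $ i" and aj: "0 < a $ j" using assms[of i] assms[of j] by auto
    have "x \<in> (\<lambda>x. replace_axis a i x + - axis i 1) ` {x. x $ j = - 1}"
      if "x \<in> tile a (Some i)" "x \<in> tile a (Some j)" for x
    proof -
      from that(1) obtain y t where y: "y \<in> cbox (- 1) 1" "y $ i = - 1" "x = y + t *\<^sub>R a"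
        unfolding in_tile_Some by blast
      from that(2) obtain y' t' where y': "y' \<in> cbox (- 1) 1" "y' $ j = - 1" "x = y' + t' *\<^sub>R a"
        unfolding in_tile_Some by blast
      have eq: "y $ k - y' $ k = (t' - t) * a $ k" for k
        using y(3) y'(3) by (simp add: vec_eq_iff algebra_simps)
      have "- 1 \<le> y' $ i" "- 1 \<le> y $ j" using y(1) y'(1) by (simp_all add: mem_box_cart)
      then have "(t' - t) * a $ i \<le> 0" "0 \<le> (t' - t) * a $ j"
        using eq[of i] eq[of j] y(2) y'(2) by linarith+
      then have "t' = t" using ai aj by (simp add: mult_le_0_iff zero_le_mult_iff)
      then have "y $ j = - 1" using eq[of j] y'(2) by simp
      then have "(\<chi> j. if j = i then t else y $ j) \<in> {x. x $ j = - 1}" using \<open>i \<noteq> j\<close> by simp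
      moreover have "x = replace_axis a i (\<chi> j. if j = i then t else y $ j) + - axis i 1"
        using y(2,3) by (simp add: replace_axis_def vec_eq_iff axis_def)
      ultimately show ?thesis by blast
    qed
    then show ?thesis by (intro negligible_subset[OF negligible_tile_face]) auto
  qed
  show ?thesis
    unfolding pairwise_def
  proof (intro ballI impI)
    fix s t :: "'a option" assume "s \<noteq> t"
    then show "negligible (tile a s \<inter> tile a t)"
      using top side by (cases s; cases t) (auto simp: Int_commute)
  qed
qed

section \<open>The isotropic constant in terms of the tile volumes\<close>

text \<open>
  The moments of a parallelepiped with centre \<open>b\<close>; the columns of \<open>M\<close> are the generators.
\<close>

lemma cube_affine_image_moments:
  fixes f :: "real^'n \<Rightarrow> real^'n" and b :: "real^'n"
  assumes f: "linear f"
  defines "T \<equiv> (\<lambda>x. f x + b) ` cbox (- 1) 1" and "M \<equiv> matrix f"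
  shows "((\<lambda>x. 1) has_integral 2 ^ CARD('n) * \<bar>det M\<bar>) T"
    and "((\<lambda>x. x $ i) has_integral 2 ^ CARD('n) * (\<bar>det M\<bar> * b $ i)) T"
    and "((\<lambda>x. x $ i * x $ j) has_integral 2 ^ CARD('n) *
      (\<bar>det M\<bar> * ((\<Sum>k\<in>UNIV. M $ i $ k * M $ j $ k) / 3 + b $ i * b $ j))) T"
proof -
  note moments = affine_image_moments[OF f compact_cbox[of "- 1" 1], where b = b, folded T_def M_def,
      unfolded cube_moments]
  show "((\<lambda>x. 1) has_integral 2 ^ CARD('n) * \<bar>det M\<bar>) T"
    using moments(1) by (simp add: mult.commute)
  show "((\<lambda>x. x $ i) has_integral 2 ^ CARD('n) * (\<bar>det M\<bar> * b $ i)) T"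
    using moments(2)[of i] by (simp add: mult_ac)
  have diagonal: "(\<Sum>k\<in>UNIV. \<Sum>l\<in>UNIV. M $ i $ k * M $ j $ l * (if k = l then 2 ^ CARD('n) / 3 else 0))
      = 2 ^ CARD('n) * ((\<Sum>k\<in>UNIV. M $ i $ k * M $ j $ k) / 3)"
    by (simp add: if_distrib[where f = "\<lambda>x. _ * x"] sum_divide_distrib sum_distrib_left mult_ac cong: if_cong)
  show "((\<lambda>x. x $ i * x $ j) has_integral 2 ^ CARD('n) *
      (\<bar>det M\<bar> * ((\<Sum>k\<in>UNIV. M $ i $ k * M $ j $ k) / 3 + b $ i * b $ j))) T"
    using moments(3)[of i j, unfolded diagonal] by (simp add: algebra_simps)
qed

lemma matrix_replace_axis_mult_transpose:
  "(\<Sum>k\<in>UNIV. matrix (replace_axis a l) $ i $ k * matrix (replace_axis a l) $ j $ k) =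
    a $ i * a $ j + (if i = j \<and> i \<noteq> l then 1 else 0)"
proof -
  have "(\<Sum>k\<in>UNIV. matrix (replace_axis a l) $ i $ k * matrix (replace_axis a l) $ j $ k) =
      (\<Sum>k\<in>UNIV. (if k = l then a $ i * a $ j else 0) + (if k = i then if i = j \<and> i \<noteq> l then 1 else 0 else 0))"
    by (rule sum.cong) (auto simp: matrix_replace_axis mat_def)
  then show ?thesis by (simp only: sum.distrib sum.delta finite UNIV_I if_True)
qed

lemma compact_cube_zonotope: "compact (cube_zonotope a)"
  unfolding cube_zonotope_def set_plus_image split_def
  by (intro compact_continuous_image compact_Times continuous_intros) simp_all

text \<open>
  Summation over the tiles. Tile \<open>None\<close> has relative weight 1 and centre \<open>a\<close>, tile \<open>Some i\<close> has relative weight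
  \<open>a $ i\<close> and centre \<open>- axis i 1\<close>; hence the centres balance out. In the second moments, every
  generator contributes a third of its square from each tile it spans, and its full square from
  the tile of which it is the centre up to sign.
\<close>

lemma cube_zonotope_moments:
  fixes a :: "real^'n"
  assumes a: "\<And>i. 0 \<le> a $ i"
  defines "W \<equiv> 1 + (\<Sum>k\<in>UNIV. a $ k)"
  shows "measure lborel (cube_zonotope a) = 2 ^ CARD('n) * W"
    and "integral (cube_zonotope a) (\<lambda>x. x $ i) = 0"
    and "integral (cube_zonotope a) (\<lambda>x. x $ i * x $ j) =
      2 ^ CARD('n) / 3 * ((W + 2) * (a $ i * a $ j) + (if i = j then W + 2 * a $ i else 0))"
proof -
  have tiles: "(h has_integral (\<Sum>s\<in>UNIV. g s)) (cube_zonotope a)"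
    if "\<And>s. (h has_integral g s) (tile a s)" for h :: "real^'n \<Rightarrow> real" and g
    unfolding cube_zonotope_eq_Union_tiles[OF a]
    by (rule has_integral_UN) (use that pairwise_negligible_tiles[OF a] in auto)
  note moments = cube_affine_image_moments
  let ?c = "2 ^ CARD('n) :: real"
  have "((\<lambda>x. 1) has_integral ?c * (case s of None \<Rightarrow> 1 | Some k \<Rightarrow> a $ k)) (tile a s)" for s
    using moments(1)[OF linear_id, of a] moments(1)[OF linear_replace_axis, of a _ "- axis _ 1"] a
    by (cases s) (simp_all add: tile_def matrix_id_mat_1 det_matrix_replace_axis)
  from tiles[OF this] show "measure lborel (cube_zonotope a) = ?c * W"
    using measure_eq_integral_one[OF compact_cube_zonotope]
    by (simp add: sum_UNIV_option W_def distrib_left sum_distrib_left)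
  have "((\<lambda>x. x $ i) has_integral
      ?c * (case s of None \<Rightarrow> a $ i | Some k \<Rightarrow> a $ k * - axis k 1 $ i)) (tile a s)" for s
    using moments(2)[OF linear_id, of i a] moments(2)[OF linear_replace_axis, of i a _ "- axis _ 1"] a
    by (cases s) (simp_all add: tile_def matrix_id_mat_1 det_matrix_replace_axis)
  note mean = tiles[OF this]
  have "(\<Sum>k\<in>UNIV. a $ k * - axis k 1 $ i) = - a $ i"
    by (simp add: axis_def if_distrib cong: if_cong)
  then show "integral (cube_zonotope a) (\<lambda>x. x $ i) = 0"
    using mean[THEN integral_unique] by (simp add: sum_UNIV_option flip: sum_distrib_left)
  have "((\<lambda>x. x $ i * x $ j) has_integral ?c * (case s of
        None \<Rightarrow> (if i = j then 1 else 0) / 3 + a $ i * a $ j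
      | Some k \<Rightarrow> a $ k * ((a $ i * a $ j + (if i = j \<and> i \<noteq> k then 1 else 0)) / 3
          + (if i = j \<and> i = k then 1 else 0)))) (tile a s)" for s
  proof (cases s)
    case None
    have "(\<Sum>k\<in>UNIV. (mat 1 :: real^'n^'n) $ i $ k * mat 1 $ j $ k) = (if i = j then 1 else 0)"
      by (subst sum.cong[OF refl, of _ _ "\<lambda>k. if k = i then if i = j then 1 else 0 else 0"])
        (auto simp: mat_def)
    then show ?thesis
      using moments(3)[OF linear_id, of i j a] None by (simp add: tile_def matrix_id_mat_1)
  next
    case (Some k)
    have "- axis k 1 $ i * - axis k 1 $ j = (if i = j \<and> i = k then 1 else 0 :: real)"
      by (simp add: axis_def)
    then show ?thesis
      using moments(3)[OF linear_replace_axis, of i j a k "- axis k 1"] a Some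
      by (simp add: tile_def matrix_replace_axis_mult_transpose det_matrix_replace_axis)
  qed
  note second = tiles[OF this]
  have "(\<Sum>k\<in>UNIV. a $ k * ((a $ i * a $ j + (if i = j \<and> i \<noteq> k then 1 else 0)) / 3
          + (if i = j \<and> i = k then 1 else 0))) =
      (\<Sum>k\<in>UNIV. a $ k * ((a $ i * a $ j + (if i = j then 1 else 0)) / 3)
          + (if k = i then if i = j then 2 / 3 * a $ i else 0 else 0))"
    by (rule sum.cong) (auto simp: field_simps)
  also have "\<dots> = (W - 1) * ((a $ i * a $ j + (if i = j then 1 else 0)) / 3)
      + (if i = j then 2 / 3 * a $ i else 0)"
    by (simp add: sum.distrib W_def sum_distrib_right)
  finally show "integral (cube_zonotope a) (\<lambda>x. x $ i * x $ j) =
      ?c / 3 * ((W + 2) * (a $ i * a $ j) + (if i = j then W + 2 * a $ i else 0))"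
    using second[THEN integral_unique]
    by (simp add: sum_UNIV_option flip: sum_distrib_left) (simp add: field_simps)
qed

text \<open>
  One plus twice the share of the volume that a tile takes up.
\<close>

definition tile_profile :: "real^'n \<Rightarrow> 'n option \<Rightarrow> real" where
  "tile_profile a s = 1 + 2 * (case s of None \<Rightarrow> 1 | Some i \<Rightarrow> a $ i) / (1 + (\<Sum>k\<in>UNIV. a $ k))"

text \<open>
  With \<open>z\<^sub>s\<close> the generators and \<open>p\<^sub>s\<close> the volume shares of the tiles, the covariance matrix is one third
  of \<open>\<Sum>s. (1 + 2 p\<^sub>s) z\<^sub>s z\<^sub>s\<^sup>T\<close>, that is, a diagonal matrix plus a multiple of \<open>a a\<^sup>T\<close>. The rank-one
  formula for its determinant becomes symmetric in all \<open>n + 1\<close> tiles after division by the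
  squared volume, because \<open>a $ i\<close> is the quotient of the shares of \<open>Some i\<close> and \<open>None\<close>.
\<close>

lemma isotropic_constant_cube_zonotope:
  fixes a :: "real^'n"
  assumes a: "\<And>i. 0 \<le> a $ i"
  shows "isotropic_constant (cube_zonotope a) =
    root (2 * CARD('n)) (moment_factor (tile_profile a) / (4 * 12 ^ CARD('n)))"
proof -
  let ?n = "CARD('n)"
  define W where "W = 1 + (\<Sum>k\<in>UNIV. a $ k)"
  define d where "d i = 1 + 2 * a $ i / W" for i
  define c where "c = 1 + 2 / W"
  have W: "0 < W" unfolding W_def using a by (intro add_pos_nonneg sum_nonneg) simp_all
  have d: "0 < d i" for i
    unfolding d_def using a[of i] W by (intro add_pos_nonneg) simp_all
  have c: "0 < c" unfolding c_def using W by (simp add: add_pos_pos)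
  note moments = cube_zonotope_moments[OF a, folded W_def]
  have "0 < measure lborel (cube_zonotope a)" using W by (simp add: moments(1))
  note cov = covariance_matrix_nth[OF compact_cube_zonotope this, unfolded moments]
  have "covariance_matrix (cube_zonotope a) =
      (\<chi> i j. (if i = j then d i / 3 else 0) + (c / 3 * a $ i) * a $ j)"
    using W by (simp add: vec_eq_iff cov d_def c_def field_simps)
  then have "det (covariance_matrix (cube_zonotope a)) =
      (\<Prod>i\<in>UNIV. d i / 3) * (1 + (\<Sum>i\<in>UNIV. (c / 3 * a $ i) * a $ i / (d i / 3)))"
    using d det_diagonal_plus_rank_one[of "\<lambda>i. d i / 3" "\<lambda>i. c / 3 * a $ i" "\<lambda>i. a $ i"]
    by (simp add: less_imp_neq[symmetric])
  also have "(\<Sum>i\<in>UNIV. (c / 3 * a $ i) * a $ i / (d i / 3)) = c * (\<Sum>i\<in>UNIV. (a $ i)\<^sup>2 / d i)"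
    by (simp add: sum_distrib_left power2_eq_square mult.assoc)
  also have "(\<Prod>i\<in>UNIV. d i / 3) = (\<Prod>i\<in>UNIV. d i) / 3 ^ ?n"
    by (simp add: prod_dividef)
  also have "(\<Sum>i\<in>UNIV. (a $ i)\<^sup>2 / d i) = (\<Sum>i\<in>UNIV. W\<^sup>2 / 4 * (d i - 2 + 1 / d i))"
  proof (rule sum.cong)
    fix i
    \<comment> \<open>the same rewriting \<open>p\<^sup>2 / y = (y - 2 + 1 / y) / 4\<close> that underlies the definition of the moment factor\<close>
    have "a $ i = W * (d i - 1) / 2" using W by (simp add: d_def)
    then have "(a $ i)\<^sup>2 = W\<^sup>2 / 4 * (d i - 1)\<^sup>2"
      by (simp only: power_divide power_mult_distrib) simp
    then show "(a $ i)\<^sup>2 / d i = W\<^sup>2 / 4 * (d i - 2 + 1 / d i)"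
      using d[of i] by (simp add: field_simps power2_eq_square)
  qed simp
  also have "\<dots> = W\<^sup>2 / 4 * ((\<Sum>i\<in>UNIV. d i) - 2 * ?n + (\<Sum>i\<in>UNIV. 1 / d i))"
    by (simp only: sum_distrib_left[symmetric]) (simp add: sum.distrib sum_subtractf)
  also have "(\<Sum>i\<in>UNIV. d i) = ?n + 2 - 2 / W"
  proof -
    have "(\<Sum>i\<in>UNIV. d i) = ?n + 2 * (W - 1) / W"
      by (simp add: d_def W_def sum.distrib flip: sum_distrib_left sum_divide_distrib)
    then show ?thesis using W by (simp add: field_simps)
  qed
  finally have det: "det (covariance_matrix (cube_zonotope a)) = (\<Prod>i\<in>UNIV. d i) / 3 ^ ?n *
      (1 + c * (W\<^sup>2 / 4 * (?n + 2 - 2 / W - 2 * ?n + (\<Sum>i\<in>UNIV. 1 / d i))))" .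
  have "moment_factor (tile_profile a) =
      c * (\<Prod>i\<in>UNIV. d i) * (1 / c + (\<Sum>i\<in>UNIV. 1 / d i) - (?n - 1))"
    by (simp add: moment_factor_def tile_profile_def sum_UNIV_option prod_UNIV_option d_def c_def W_def
        algebra_simps)
  also have "\<dots> = (\<Prod>i\<in>UNIV. d i) * (1 + c * ((\<Sum>i\<in>UNIV. 1 / d i) - (?n - 1)))"
    using c by (simp add: field_simps)
  also have "1 + c * ((\<Sum>i\<in>UNIV. 1 / d i) - (?n - 1)) =
      4 * (1 + c * (W\<^sup>2 / 4 * (?n + 2 - 2 / W - 2 * ?n + (\<Sum>i\<in>UNIV. 1 / d i)))) / W\<^sup>2"
    using W by (simp add: c_def field_simps power2_eq_square)
  finally have factor: "moment_factor (tile_profile a) = (\<Prod>i\<in>UNIV. d i) * (4 *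
      (1 + c * (W\<^sup>2 / 4 * (?n + 2 - 2 / W - 2 * ?n + (\<Sum>i\<in>UNIV. 1 / d i)))) / W\<^sup>2)" .
  define E where "E = 1 + c * (W\<^sup>2 / 4 * (?n + 2 - 2 / W - 2 * ?n + (\<Sum>i\<in>UNIV. 1 / d i)))"
  have twelve: "(12::real) ^ ?n = 3 ^ ?n * (2 ^ ?n)\<^sup>2"
    by (simp add: power2_eq_square flip: power_mult_distrib)
  have "moment_factor (tile_profile a) / (4 * 12 ^ ?n) =
      det (covariance_matrix (cube_zonotope a)) / (2 ^ ?n * W)\<^sup>2"
    unfolding det factor E_def[symmetric] twelve by (simp add: power_mult_distrib)
  then show ?thesis by (simp add: isotropic_constant_def moments(1))
qed

text \<open>
  The entries of the profile sum to \<open>n + 3\<close> for every \<open>a\<close>, so their mean is \<open>1 + 2 / (n + 1)\<close>. They are all equal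
  exactly if all tiles have the same volume, which means \<open>a = 1\<close>.
\<close>

lemma isotropic_constant_cube_zonotope_minimal:
  fixes a :: "real^'n"
  assumes a: "\<And>i. 0 \<le> a $ i" and n: "2 \<le> CARD('n)" and "a \<noteq> 1"
  shows "isotropic_constant (cube_zonotope (1 :: real^'n)) < isotropic_constant (cube_zonotope a)"
proof -
  let ?n = "CARD('n)"
  define W where "W = 1 + (\<Sum>k\<in>UNIV. a $ k)"
  define \<mu> where "\<mu> = 1 + 2 / (1 + real ?n)"
  have W: "0 < W" unfolding W_def using a by (intro add_pos_nonneg sum_nonneg) simp_all
  have one: "tile_profile (1 :: real^'n) = (\<lambda>s. \<mu>)"
    by (auto simp: tile_profile_def \<mu>_def split: option.split)
  have profile: "tile_profile a None = 1 + 2 / W" "tile_profile a (Some i) = 1 + 2 * a $ i / W" for i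
    by (simp_all add: tile_profile_def W_def)
  have "moment_factor (\<lambda>s::'n option. \<mu>) < moment_factor (tile_profile a)"
  proof (rule moment_factor_minimal_at_constant)
    show "3 \<le> CARD('n option)" using n by simp
    show "1 \<le> tile_profile a s" for s
      using a W by (cases s) (simp_all add: profile)
    have "(\<Sum>i\<in>UNIV. tile_profile a (Some i)) = ?n + 2 * (W - 1) / W"
      by (simp add: profile W_def sum.distrib flip: sum_distrib_left sum_divide_distrib)
    then have "(\<Sum>s\<in>UNIV. tile_profile a s) = ?n + 3"
      using W by (simp add: sum_UNIV_option profile field_simps)
    then show "(\<Sum>s\<in>UNIV. tile_profile a s) = real CARD('n option) * \<mu>"
      by (simp add: \<mu>_def field_simps)
    show "1 < \<mu>" by (simp add: \<mu>_def)
    show "\<exists>s. tile_profile a s \<noteq> \<mu>"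
    proof (rule ccontr)
      assume "\<not> ?thesis"
      then have eq: "tile_profile a s = \<mu>" for s by simp
      have "a $ i = 1" for i
        using eq[of "Some i"] eq[of None] W by (simp add: profile field_simps)
      then show False using \<open>a \<noteq> 1\<close> by (simp add: vec_eq_iff)
    qed
  qed
  then show ?thesis
    using n by (simp add: isotropic_constant_cube_zonotope a one divide_strict_right_mono)
qed

section \<open>Reduction to a cube with one additional generator\<close>

lemma sum_symmetric_segments:
  fixes z :: "'i \<Rightarrow> 'a::real_vector"
  assumes "finite I"
  shows "x \<in> (\<Sum>i\<in>I. closed_segment (- z i) (z i)) \<longleftrightarrow>
    (\<exists>t. (\<forall>i\<in>I. \<bar>t i\<bar> \<le> 1) \<and> x = (\<Sum>i\<in>I. t i *\<^sub>R z i))"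
proof -
  have "x \<in> (\<Sum>i\<in>I. closed_segment (- z i) (z i)) \<longleftrightarrow>
      (\<exists>s. x = sum s I \<and> (\<forall>i\<in>I. \<exists>t. \<bar>t\<bar> \<le> 1 \<and> s i = t *\<^sub>R z i))"
    by (simp add: set_sum_alt[OF assms] in_closed_segment_symmetric)
  also have "\<dots> \<longleftrightarrow> (\<exists>t. (\<forall>i\<in>I. \<bar>t i\<bar> \<le> 1) \<and> x = (\<Sum>i\<in>I. t i *\<^sub>R z i))"
  proof
    assume "\<exists>s. x = sum s I \<and> (\<forall>i\<in>I. \<exists>t. \<bar>t\<bar> \<le> 1 \<and> s i = t *\<^sub>R z i)"
    then obtain s where s: "x = sum s I" "\<forall>i\<in>I. \<exists>t. \<bar>t\<bar> \<le> 1 \<and> s i = t *\<^sub>R z i" by blast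
    from bchoice[OF s(2)] obtain t where "\<forall>i\<in>I. \<bar>t i\<bar> \<le> 1 \<and> s i = t i *\<^sub>R z i" by blast
    then show "\<exists>t. (\<forall>i\<in>I. \<bar>t i\<bar> \<le> 1) \<and> x = (\<Sum>i\<in>I. t i *\<^sub>R z i)"
      using s(1) by (intro exI[of _ t]) (simp cong: sum.cong)
  qed blast
  finally show ?thesis .
qed

lemma Q_zonotope_eq_cube_zonotope: "Q_zonotope = cube_zonotope (1 :: real^'n)"
proof -
  have ones: "(\<Sum>i\<in>UNIV. axis i 1) = (1 :: real^'n)"
    by (simp add: vec_eq_iff axis_def)
  have "(\<Sum>i\<in>UNIV. closed_segment (- axis i 1) (axis i 1)) = cbox (- 1) (1 :: real^'n)"
  proof (intro set_eqI)
    fix x :: "real^'n"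
    have "x = (\<Sum>i\<in>UNIV. t i *\<^sub>R axis i 1) \<longleftrightarrow> (\<forall>i. x $ i = t i)" for t
      by (simp add: vec_eq_iff axis_def if_distrib cong: if_cong)
    then show "x \<in> (\<Sum>i\<in>UNIV. closed_segment (- axis i 1) (axis i 1)) \<longleftrightarrow> x \<in> cbox (- 1) 1"
      by (auto simp: sum_symmetric_segments mem_box_cart abs_le_iff minus_le_iff intro!: exI[of _ "\<lambda>i. x $ i"])
  qed
  then show ?thesis by (simp add: Q_zonotope_def cube_zonotope_def ones)
qed

text \<open>
  A zonotope with interior points has generators that span the space. Choose a basis among them;
  at most one generator \<open>w\<close> remains, and \<open>w = 0\<close> may be taken if there is none. In the coordinates of this basis
  the basis generators form the cube, and changing the signs of basis vectors, which
  leaves their segments unchanged, makes the coordinates of \<open>w\<close> nonnegative.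
\<close>

lemma zonotope_eq_affine_image_cube_zonotope:
  fixes Z :: "(real^'n) set"
  assumes zon: "zonotope m Z" and m: "m \<le> CARD('n) + 1" and int: "interior Z \<noteq> {}"
  obtains f :: "real^'n \<Rightarrow> real^'n" and c a
  where "linear f" "bij f" "\<And>i. 0 \<le> a $ i" "Z = (\<lambda>x. f x + c) ` cube_zonotope a"
proof -
  obtain c and z :: "nat \<Rightarrow> real^'n" where Z: "Z = {c} + (\<Sum>i<m. closed_segment (- z i) (z i))"
    using zon unfolding zonotope_def by blast
  have inZ: "x \<in> Z \<longleftrightarrow> (\<exists>t. (\<forall>i<m. \<bar>t i\<bar> \<le> 1) \<and> x = c + (\<Sum>i<m. t i *\<^sub>R z i))" for x
    unfolding Z set_plus_def by (simp add: Bex_def Ball_def sum_symmetric_segments) blast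
  let ?G = "z ` {..<m}"
  have spanG: "span ?G = UNIV"
  proof (rule ccontr)
    assume "span ?G \<noteq> UNIV"
    then have "dim (span ?G) < DIM(real^'n)"
      using dim_eq_full[of ?G] dim_subset_UNIV[of "span ?G"] by (simp add: le_neq_implies_less)
    then have empty: "interior (span ?G) = {}" by (rule empty_interior_lowdim)
    have "(\<Sum>i<m. t i *\<^sub>R z i) \<in> span ?G" for t
      by (intro span_sum span_scale span_base) auto
    then have "Z \<subseteq> (+) c ` span ?G"
      by (auto simp: inZ)
    then have "interior Z \<subseteq> interior ((+) c ` span ?G)" by (rule interior_mono)
    then show False using int empty by (simp add: interior_translation)
  qed
  obtain B where B: "B \<subseteq> ?G" "independent B" "?G \<subseteq> span B"
    by (rule maximal_independent_subset)
  have spanB: "span B = UNIV"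
    using span_mono[OF B(3)] spanG by (simp add: span_span top.extremum_unique)
  have cardB: "card B = CARD('n)"
    using dim_eq_card[of B UNIV] B(2) spanB by (simp add: dim_UNIV)
  obtain I where I: "I \<subseteq> {..<m}" "inj_on z I" "B = z ` I"
    using B(1) by (auto simp: subset_image_inj)
  have finI: "finite I" using I(1) finite_subset by blast
  have cardI: "card I = CARD('n)" using cardB I by (simp add: card_image)
  then obtain \<sigma> :: "'n \<Rightarrow> nat" where \<sigma>: "bij_betw \<sigma> UNIV I"
    using finite_same_card_bij[of "UNIV :: 'n set" I] finI by auto
  have sum_I: "(\<Sum>i\<in>I. h i) = (\<Sum>k\<in>UNIV. h (\<sigma> k))" for h :: "nat \<Rightarrow> real^'n"
    by (rule sum.reindex_bij_betw[OF \<sigma>, symmetric])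
  have basis: "\<exists>u. x = (\<Sum>k\<in>UNIV. u k *\<^sub>R z (\<sigma> k))" for x
  proof -
    have "x \<in> span (z ` I)" using spanB I(3) by simp
    then obtain u where "x = (\<Sum>v\<in>z ` I. u v *\<^sub>R v)"
      using finI by (auto simp: span_finite)
    then have "x = (\<Sum>k\<in>UNIV. u (z (\<sigma> k)) *\<^sub>R z (\<sigma> k))"
      using I(2) by (simp add: sum.reindex sum_I)
    then show ?thesis by (rule exI[of _ "\<lambda>k. u (z (\<sigma> k))"])
  qed
  define R where "R = {..<m} - I"
  have "card R \<le> 1"
    using I(1) finI cardI m by (simp add: R_def card_Diff_subset)
  moreover have "finite R" by (simp add: R_def)
  ultimately consider "R = {}" | r where "R = {r}"
    using card_1_singletonE le_Suc_eq by (metis One_nat_def card_eq_0_iff le_zero_eq)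
  then obtain w where w: "\<And>x. (\<exists>t. (\<forall>i\<in>R. \<bar>t i\<bar> \<le> 1) \<and> x = (\<Sum>i\<in>R. t i *\<^sub>R z i)) \<longleftrightarrow>
      (\<exists>u. \<bar>u\<bar> \<le> 1 \<and> x = u *\<^sub>R w)"
  proof cases
    case 1
    then show ?thesis by (intro that[of 0]) (auto intro: exI[of _ 0])
  next
    case (2 r)
    then show ?thesis by (intro that[of "z r"]) (auto intro: exI[of _ "\<lambda>_. u" for u])
  qed
  obtain v where v: "w = (\<Sum>k\<in>UNIV. v k *\<^sub>R z (\<sigma> k))" using basis by blast
  define s where "s k = (if v k < 0 then - 1 else 1 :: real)" for k
  have s: "s k * s k = 1" "\<bar>s k\<bar> = 1" for k by (simp_all add: s_def)
  define f :: "real^'n \<Rightarrow> real^'n" where "f x = (\<Sum>k\<in>UNIV. (s k * x $ k) *\<^sub>R z (\<sigma> k))" for x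
  define a where "a = (\<chi> k. \<bar>v k\<bar>)"
  have flip: "f (\<chi> k. s k * u k) = (\<Sum>k\<in>UNIV. u k *\<^sub>R z (\<sigma> k))" for u
    by (simp add: f_def s flip: mult.assoc)
  have lin: "linear f"
    by (rule linearI) (simp_all add: f_def algebra_simps sum.distrib scaleR_sum_right)
  have "surj f"
    using basis flip by (metis surjI surj_def)
  then have bij: "bij f"
    using linear_surjective_imp_injective[OF lin] by (simp add: bij_def)
  have fa: "f a = w"
  proof -
    have "a = (\<chi> k. s k * v k)" by (simp add: a_def s_def vec_eq_iff)
    then show ?thesis using flip v by simp
  qed
  have "x \<in> Z \<longleftrightarrow> x \<in> (\<lambda>x. f x + c) ` cube_zonotope a" for x
  proof
    assume "x \<in> Z"
    then obtain t where t: "\<forall>i<m. \<bar>t i\<bar> \<le> 1" "x = c + (\<Sum>i<m. t i *\<^sub>R z i)"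
      unfolding inZ by blast
    have "{..<m} = I \<union> R" "I \<inter> R = {}" using I(1) by (auto simp: R_def)
    then have split: "(\<Sum>i<m. t i *\<^sub>R z i) = (\<Sum>i\<in>I. t i *\<^sub>R z i) + (\<Sum>i\<in>R. t i *\<^sub>R z i)"
      using finI \<open>finite R\<close> by (simp add: sum.union_disjoint)
    have "\<forall>i\<in>R. \<bar>t i\<bar> \<le> 1" using t(1) by (simp add: R_def)
    then obtain u where u: "\<bar>u\<bar> \<le> 1" "(\<Sum>i\<in>R. t i *\<^sub>R z i) = u *\<^sub>R w"
      using w[of "\<Sum>i\<in>R. t i *\<^sub>R z i"] by blast
    let ?y = "\<chi> k. s k * t (\<sigma> k)"
    have "\<sigma> k < m" for k using \<sigma> I(1) by (auto simp: bij_betw_def)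
    then have "\<bar>?y $ k\<bar> \<le> 1" for k using t(1) by (simp add: abs_mult s)
    then have "?y \<in> cbox (- 1) 1" by (auto simp: mem_box_cart abs_le_iff minus_le_iff)
    then have "?y + u *\<^sub>R a \<in> cube_zonotope a" using u(1) unfolding in_cube_zonotope by blast
    moreover have "x = f (?y + u *\<^sub>R a) + c"
      unfolding t(2) split u(2) by (simp add: linear_add[OF lin] linear_scale[OF lin] fa flip sum_I)
    ultimately show "x \<in> (\<lambda>x. f x + c) ` cube_zonotope a" by blast
  next
    assume "x \<in> (\<lambda>x. f x + c) ` cube_zonotope a"
    then obtain p where "p \<in> cube_zonotope a" "x = f p + c" by blast
    then obtain y u where y: "y \<in> cbox (- 1) 1" "\<bar>u\<bar> \<le> 1" "x = f (y + u *\<^sub>R a) + c"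
      unfolding in_cube_zonotope by blast
    obtain t where t: "\<forall>i\<in>R. \<bar>t i\<bar> \<le> 1" "u *\<^sub>R w = (\<Sum>i\<in>R. t i *\<^sub>R z i)"
      using w[of "u *\<^sub>R w"] y(2) by blast
    define t' where "t' i = (if i \<in> R then t i else s (inv_into UNIV \<sigma> i) * y $ inv_into UNIV \<sigma> i)" for i
    have "\<bar>y $ k\<bar> \<le> 1" for k using y(1) by (auto simp: mem_box_cart abs_le_iff minus_le_iff)
    then have "\<forall>i<m. \<bar>t' i\<bar> \<le> 1" using t(1) by (simp add: t'_def abs_mult s)
    moreover have "(\<Sum>i<m. t' i *\<^sub>R z i) = f y + u *\<^sub>R w"
    proof -
      have "{..<m} = I \<union> R" "I \<inter> R = {}" using I(1) by (auto simp: R_def)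
      then have "(\<Sum>i<m. t' i *\<^sub>R z i) = (\<Sum>i\<in>I. t' i *\<^sub>R z i) + (\<Sum>i\<in>R. t' i *\<^sub>R z i)"
        using finI \<open>finite R\<close> by (simp add: sum.union_disjoint)
      moreover have "(\<Sum>i\<in>R. t' i *\<^sub>R z i) = u *\<^sub>R w" unfolding t(2) by (simp add: t'_def)
      moreover have "\<sigma> k \<notin> R" "inv_into UNIV \<sigma> (\<sigma> k) = k" for k
        using \<sigma> by (auto simp: bij_betw_def R_def inv_into_f_f)
      then have "(\<Sum>i\<in>I. t' i *\<^sub>R z i) = f y" by (simp add: sum_I f_def t'_def)
      ultimately show ?thesis by simp
    qed
    ultimately show "x \<in> Z" unfolding inZ y(3)
      by (intro exI[of _ t']) (simp add: linear_add[OF lin] linear_scale[OF lin] fa)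
  qed
  then show ?thesis using lin bij by (intro that[of f a c]) (auto simp: a_def)
qed

lemma affinely_equivalent_sym:
  assumes "affinely_equivalent S T"
  shows "affinely_equivalent T S"
proof -
  obtain f b where f: "linear f" "bij f" "T = (\<lambda>x. f x + b) ` S"
    using assms unfolding affinely_equivalent_def by blast
  let ?g = "inv f"
  have "linear ?g"
  proof (rule linearI)
    fix x y r
    have fg: "f (?g x) = x" for x using f(2) by (simp add: bij_is_surj surj_f_inv_f)
    show "?g (x + y) = ?g x + ?g y"
      using f(2) by (intro inv_f_eq) (simp_all add: bij_is_inj linear_add[OF f(1)] fg)
    show "?g (r *\<^sub>R x) = r *\<^sub>R ?g x"
      using f(2) by (intro inv_f_eq) (simp_all add: bij_is_inj linear_scale[OF f(1)] fg)
  qed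
  moreover have "bij ?g" using f(2) by (rule bij_imp_bij_inv)
  moreover have "S = (\<lambda>y. ?g y + - ?g b) ` T"
    unfolding f(3) image_image
    using f(2) by (simp add: linear_add[OF \<open>linear ?g\<close>] bij_is_inj)
  ultimately show ?thesis unfolding affinely_equivalent_def by blast
qed

theorem proposition6p5:
  fixes Z :: "(real ^ 'n) set"
  assumes "CARD('n) \<ge> 2"
    and "\<exists>m \<le> CARD('n) + 1. zonotope m Z"
    and "interior Z \<noteq> {}"
  shows "isotropic_constant Z \<ge> isotropic_constant (Q_zonotope :: (real ^ 'n) set)
    \<and> (isotropic_constant Z = isotropic_constant (Q_zonotope :: (real ^ 'n) set)
         \<longleftrightarrow> affinely_equivalent Z Q_zonotope)"
proof -
  let ?Q = "Q_zonotope :: (real^'n) set"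
  note Q = Q_zonotope_eq_cube_zonotope[where 'n = 'n]
  obtain m where m: "m \<le> CARD('n) + 1" "zonotope m Z" using assms(2) by blast
  obtain f :: "real^'n \<Rightarrow> real^'n" and c a where f: "linear f" "bij f"
    and a: "\<And>i. 0 \<le> a $ i" and Z: "Z = (\<lambda>x. f x + c) ` cube_zonotope a"
    by (rule zonotope_eq_affine_image_cube_zonotope[OF m(2,1) assms(3)]) (rule that)
  have invariant: "isotropic_constant ((\<lambda>x. g x + b) ` cube_zonotope a) = isotropic_constant (cube_zonotope a)"
    if "linear g" "bij g" "\<And>i. 0 \<le> a $ i" for g :: "real^'n \<Rightarrow> real^'n" and b a
  proof (rule isotropic_constant_affine_invariant[OF that(1,2) compact_cube_zonotope])
    have "0 < 1 + (\<Sum>k\<in>UNIV. a $ k)" using that(3) by (intro add_pos_nonneg sum_nonneg) simp_all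
    then show "0 < measure lborel (cube_zonotope a)"
      using cube_zonotope_moments(1)[OF that(3)] by simp
  qed
  have LZ: "isotropic_constant Z = isotropic_constant (cube_zonotope a)"
    unfolding Z using f a by (rule invariant)
  have strict: "isotropic_constant ?Q < isotropic_constant Z" if "a \<noteq> 1"
    unfolding LZ Q using a assms(1) that by (rule isotropic_constant_cube_zonotope_minimal)
  have "affinely_equivalent Z ?Q" if "a = 1"
  proof -
    have "affinely_equivalent ?Q Z"
      unfolding affinely_equivalent_def Z Q using f that by blast
    then show ?thesis by (rule affinely_equivalent_sym)
  qed
  moreover have "isotropic_constant Z = isotropic_constant ?Q" if "affinely_equivalent Z ?Q"
  proof -
    obtain g b where "linear g" "bij g" "Z = (\<lambda>x. g x + b) ` ?Q"
      using affinely_equivalent_sym[OF \<open>affinely_equivalent Z ?Q\<close>] unfolding affinely_equivalent_def by blast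
    then show ?thesis unfolding Q by (simp add: invariant)
  qed
  ultimately show ?thesis
    using strict LZ Q by (cases "a = 1") auto
qed

end
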